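(* Let $\Sigma$ be a fan in $N_{\mathbb R}$ and let $w\in N_{\mathbb R}(\Sigma)\setminus N_{\mathbb R}$. If $\mathfrak L\subseteq N_{\mathbb R}$ is a polyhedron such that $w$ lies in the closure of $\mathfrak L$ in $N_{\mathbb R}(\Sigma)$, then there are $\widehat w\in\mathfrak L$ and $v\in\mathrm{rec}(\mathfrak L)$ such that $\lim_{\mathcal N\to\infty}(\widehat w+\mathcal N v)=w$ (limit in $N_{\mathbb R}(\Sigma)$, over real $\mathcal N\to\infty$).
   Context: $M$ is a finitely generated free abelian group, $M_{\mathbb R}=M\otimes\mathbb R$, $N=\mathrm{Hom}(M,\mathbb Z)$, $N_{\mathbb R}=\mathrm{Hom}(M,\mathbb R)$ with pairing $\langle v,u\rangle=v(u)$. A fan in $N_{\mathbb R}$ is a (finite) collection of strongly convex rational polyhedral cones, closed under taking faces, such that any two intersect in a common face. For a strongly convex rational polyhedral cone $\sigma$, $\sigma^\vee=\{u\in M_{\mathbb R}:\langle v,u\rangle\le 0\ \forall v\in\sigma\}$, and $N_{\mathbb R}(\sigma)$ is the set of monoid homomorphisms $\sigma^\vee\cap M\to(\mathbb R\cup\{-\infty\},+)$, topologized as a subspace of the product $(\mathbb R\cup\{-\infty\})^{\sigma^\vee\cap M}$, where $\mathbb R\cup\{-\infty\}$ carries the topology of $[0,\infty)$ via $x\mapsto e^x$. For a face $\tau\le\sigma$, restriction along $\sigma^\vee\cap M\subseteq\tau^\vee\cap M$ identifies $N_{\mathbb R}(\tau)$ with an open subset of $N_{\mathbb R}(\sigma)$;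 the tropical toric variety $N_{\mathbb R}(\Sigma)$ is obtained by gluing the $N_{\mathbb R}(\sigma)$, $\sigma\in\Sigma$, along these inclusions. $N_{\mathbb R}=N_{\mathbb R}(\{0\})\subseteq N_{\mathbb R}(\Sigma)$. A polyhedron is a finite intersection of closed half-spaces $\{x\in N_{\mathbb R}:\langle x,a_i\rangle\le b_i\}$ with $a_i\in M_{\mathbb R}$, $b_i\in\mathbb R$ (not assumed rational). For a nonempty polyhedron $\mathfrak L$, the recession cone is $\mathrm{rec}(\mathfrak L)=\{x\in N_{\mathbb R}: x+y\in\mathfrak L\ \forall y\in\mathfrak L\}$. *)

theory Defs
  imports "HOL-Analysis.Analysis"
begin

text \<open>
  The lattice \<open>M\<close> is a full-rank lattice in a Euclidean space, so the ambient type is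
  \<open>M \<otimes> \<real>\<close>. The inner product identifies the ambient space with \<open>Hom(M, \<real>)\<close> as well
  (\<open>v\<close> corresponds to \<open>u \<mapsto> v \<bullet> u\<close>; see \<open>hom_real_iff_inner\<close> below), so that the pairing of
  \<open>v\<close> with \<open>u\<close> is \<open>v \<bullet> u\<close> and \<open>N = Hom(M, \<int>)\<close> is the dual lattice.
\<close>

definition full_lattice :: "'a::euclidean_space set \<Rightarrow> bool" where
  "full_lattice M \<longleftrightarrow>
     (\<exists>B. independent B \<and> span B = UNIV \<and>
          M = range (\<lambda>c :: 'a \<Rightarrow> int. \<Sum>b\<in>B. of_int (c b) *\<^sub>R b))"

definition dual_lattice :: "'a::euclidean_space set \<Rightarrow> 'a set" where
  "dual_lattice M = {v. \<forall>u\<in>M. v \<bullet> u \<in> \<int>}"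

definition rational_cone :: "'a::euclidean_space set \<Rightarrow> 'a set \<Rightarrow> bool" where
  "rational_cone M \<sigma> \<longleftrightarrow> (\<exists>S. finite S \<and> S \<subseteq> dual_lattice M \<and> \<sigma> = convex_cone hull S)"

definition strongly_convex :: "'a::euclidean_space set \<Rightarrow> bool" where
  "strongly_convex \<sigma> \<longleftrightarrow> \<sigma> \<inter> uminus ` \<sigma> = {0}"

text \<open>\<open>(face_of)\<close> admits the empty set as a face, which is not a cone.\<close>

definition cone_face :: "'a::euclidean_space set \<Rightarrow> 'a set \<Rightarrow> bool" where
  "cone_face \<tau> \<sigma> \<longleftrightarrow> \<tau> face_of \<sigma> \<and> \<tau> \<noteq> {}"

definition fan :: "'a::euclidean_space set \<Rightarrow> 'a set set \<Rightarrow> bool" where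
  "fan M \<Sigma> \<longleftrightarrow> finite \<Sigma> \<and>
     (\<forall>\<sigma>\<in>\<Sigma>. rational_cone M \<sigma> \<and> strongly_convex \<sigma>) \<and>
     (\<forall>\<sigma>\<in>\<Sigma>. \<forall>\<tau>. cone_face \<tau> \<sigma> \<longrightarrow> \<tau> \<in> \<Sigma>) \<and>
     (\<forall>\<sigma>\<in>\<Sigma>. \<forall>\<sigma>'\<in>\<Sigma>. cone_face (\<sigma> \<inter> \<sigma>') \<sigma> \<and> cone_face (\<sigma> \<inter> \<sigma>') \<sigma>')"

text \<open>Dual cones follow the nonpositive sign convention.\<close>

definition dual_cone :: "'a::euclidean_space set \<Rightarrow> 'a set" where
  "dual_cone \<sigma> = {u. \<forall>v\<in>\<sigma>. v \<bullet> u \<le> 0}"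

abbreviation dual_monoid :: "'a::euclidean_space set \<Rightarrow> 'a set \<Rightarrow> 'a set" where
  "dual_monoid M \<sigma> \<equiv> dual_cone \<sigma> \<inter> M"

text \<open>
  The tropical numbers \<open>\<real> \<union> {-\<infinity>}\<close> carry the subspace topology of the extended reals, which
  is the topology transported from \<open>[0, \<infinity>)\<close> by the exponential map
  (\<open>homeomorphic_map_trop_exp\<close>).
\<close>

definition trop_numbers :: "ereal topology" where
  "trop_numbers = top_of_set (- {\<infinity>})"

definition trop_exp :: "ereal \<Rightarrow> real" where
  "trop_exp x = (if x = - \<infinity> then 0 else exp (real_of_ereal x))"

text \<open>
  Points of the affine chart: monoid homomorphisms, as functions that are \<open>undefined\<close>
  outside \<open>dual_monoid M \<sigma>\<close>.
\<close>

definition trop_chart_points :: "'a::euclidean_space set \<Rightarrow> 'a set \<Rightarrow> ('a \<Rightarrow> ereal) set" where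
  "trop_chart_points M \<sigma> =
     {\<phi> \<in> dual_monoid M \<sigma> \<rightarrow>\<^sub>E - {\<infinity>}.
        \<phi> 0 = 0 \<and>
        (\<forall>u\<in>dual_monoid M \<sigma>. \<forall>u'\<in>dual_monoid M \<sigma>. \<phi> (u + u') = \<phi> u + \<phi> u')}"

definition trop_chart :: "'a::euclidean_space set \<Rightarrow> 'a set \<Rightarrow> ('a \<Rightarrow> ereal) topology" where
  "trop_chart M \<sigma> =
     subtopology (product_topology (\<lambda>_. trop_numbers) (dual_monoid M \<sigma>))
       (trop_chart_points M \<sigma>)"

text \<open>
  Gluing: on the disjoint union of the charts, take the equivalence relation generated by
  identifying each point of the chart of a face \<open>\<tau>\<close> of \<open>\<sigma>\<close> with its restriction in the chart
  of \<open>\<sigma>\<close>, and form the topological quotient. Points are equivalence classes.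
\<close>

definition trop_glue ::
  "'a::euclidean_space set \<Rightarrow> 'a set set \<Rightarrow> 'a set \<times> ('a \<Rightarrow> ereal) \<Rightarrow> 'a set \<times> ('a \<Rightarrow> ereal) \<Rightarrow> bool"
  where
  "trop_glue M \<Sigma> p q \<longleftrightarrow>
     (\<exists>\<tau>\<in>\<Sigma>. \<exists>\<sigma>\<in>\<Sigma>. cone_face \<tau> \<sigma> \<and>
        (\<exists>\<psi>\<in>trop_chart_points M \<tau>. p = (\<tau>, \<psi>) \<and> q = (\<sigma>, restrict \<psi> (dual_monoid M \<sigma>))))"

definition trop_class ::
  "'a::euclidean_space set \<Rightarrow> 'a set set \<Rightarrow> 'a set \<times> ('a \<Rightarrow> ereal) \<Rightarrow> ('a set \<times> ('a \<Rightarrow> ereal)) set"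
  where
  "trop_class M \<Sigma> p = {q. equivclp (trop_glue M \<Sigma>) p q}"

definition trop_toric ::
  "'a::euclidean_space set \<Rightarrow> 'a set set \<Rightarrow> ('a set \<times> ('a \<Rightarrow> ereal)) set topology" where
  "trop_toric M \<Sigma> =
     (let X = sum_topology (trop_chart M) \<Sigma> in
      topology (\<lambda>U. U \<subseteq> trop_class M \<Sigma> ` topspace X \<and>
                    openin X {p \<in> topspace X. trop_class M \<Sigma> p \<in> U}))"

text \<open>The inclusion of \<open>Hom(M, \<real>)\<close> as the chart of the zero cone.\<close>

definition trop_embed ::
  "'a::euclidean_space set \<Rightarrow> 'a set set \<Rightarrow> 'a \<Rightarrow> ('a set \<times> ('a \<Rightarrow> ereal)) set" where
  "trop_embed M \<Sigma> x = trop_class M \<Sigma> ({0}, restrict (\<lambda>u. ereal (x \<bullet> u)) M)"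

definition recession_cone :: "'a::euclidean_space set \<Rightarrow> 'a set" where
  "recession_cone L = {x. \<forall>y\<in>L. x + y \<in> L}"

subsection \<open>Consistency of the encoding\<close>

lemma homeomorphic_map_trop_exp:
  "homeomorphic_map trop_numbers (top_of_set {0..}) trop_exp"
proof -
  define g :: "real \<Rightarrow> ereal" where "g y = (if y \<le> 0 then - \<infinity> else ereal (ln y))" for y
  have e1: "trop_exp (ereal r) = exp r" for r by (simp add: trop_exp_def)
  have e2: "trop_exp (- \<infinity>) = 0" by (simp add: trop_exp_def)
  have cf: "continuous_on (- {\<infinity>}) trop_exp"
    unfolding continuous_on_def
  proof
    fix x :: ereal assume x: "x \<in> - {\<infinity>}"
    show "(trop_exp \<longlongrightarrow> trop_exp x) (at x within - {\<infinity>})"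
    proof (cases x)
      case (real r)
      have "((\<lambda>x. exp (real_of_ereal x)) \<longlongrightarrow> exp (real_of_ereal x)) (at x within - {\<infinity>})"
        using real by (intro tendsto_exp lim_real_of_ereal) (auto intro: tendsto_eq_intros simp: ereal_real)
      moreover have "eventually (\<lambda>y. trop_exp y = exp (real_of_ereal y)) (at x within - {\<infinity>})"
        using order_tendstoD(1)[OF tendsto_ident_at, of "- \<infinity>" x "- {\<infinity>}"] real
        by (auto simp: trop_exp_def elim!: eventually_mono)
      ultimately show ?thesis
        using real by (simp add: e1 tendsto_cong)
    next
      case PInf
      then show ?thesis using x by simp
    next
      case MInf
      show ?thesis
      proof (rule order_tendstoI)
        fix a assume "a < trop_exp x"
        then have "a < 0" using MInf e2 by simp
        moreover have "0 \<le> trop_exp y" for y by (simp add: trop_exp_def)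
        ultimately show "eventually (\<lambda>y. a < trop_exp y) (at x within - {\<infinity>})"
          by (intro always_eventually) (meson less_le_trans)
      next
        fix a assume "trop_exp x < a"
        then have a: "0 < a" using MInf e2 by simp
        have "eventually (\<lambda>y. y < ereal (ln a)) (at x within - {\<infinity>})"
          using order_tendstoD(2)[OF tendsto_ident_at, of x "ereal (ln a)" "- {\<infinity>}"] MInf by simp
        then show "eventually (\<lambda>y. trop_exp y < a) (at x within - {\<infinity>})"
        proof eventually_elim
          case (elim y)
          then show ?case
            using a exp_less_cancel_iff[of _ "ln a"] by (cases y) (auto simp: e1 e2)
        qed
      qed
    qed
  qed
  have cg: "continuous_on {0..} g"
    unfolding continuous_on_def
  proof
    fix y :: real assume y: "y \<in> {0..}"
    show "(g \<longlongrightarrow> g y) (at y within {0..})"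
    proof (cases "y = 0")
      case True
      have "(g \<longlongrightarrow> - \<infinity>) (at y within {0..})"
        unfolding tendsto_MInfty
      proof
        fix r :: real
        have "eventually (\<lambda>z. z < exp r) (at y within {0..})"
          using order_tendstoD(2)[OF tendsto_ident_at, of y "exp r"] True by simp
        then show "eventually (\<lambda>z. g z < ereal r) (at y within {0..})"
        proof eventually_elim
          case (elim z)
          show ?case
          proof (cases "z \<le> 0")
            case False
            then have "ln z < r" using elim by (metis exp_less_cancel_iff exp_ln not_le)
            then show ?thesis using False by (simp add: g_def)
          qed (simp add: g_def)
        qed
      qed
      then show ?thesis using True by (simp add: g_def)
    next
      case False
      then have y0: "0 < y" using y by simp
      have "((\<lambda>z. ereal (ln z)) \<longlongrightarrow> ereal (ln y)) (at y within {0..})"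
        using y0 by (auto intro!: tendsto_intros)
      moreover have "eventually (\<lambda>z. g z = ereal (ln z)) (at y within {0..})"
        using order_tendstoD(1)[OF tendsto_ident_at y0, of "{0..}"]
        by eventually_elim (simp add: g_def)
      ultimately show ?thesis using y0 by (simp add: g_def tendsto_cong)
    qed
  qed
  have "homeomorphic_maps trop_numbers (top_of_set {0..}) trop_exp g"
    unfolding homeomorphic_maps_def
  proof (intro conjI ballI)
    show "continuous_map trop_numbers (top_of_set {0..}) trop_exp"
      using cf by (auto simp: trop_numbers_def trop_exp_def)
    show "continuous_map (top_of_set {0..}) trop_numbers g"
      using cg by (auto simp: trop_numbers_def g_def)
    show "g (trop_exp x) = x" if "x \<in> topspace trop_numbers" for x
      using that by (cases x) (auto simp: trop_numbers_def g_def e1 e2)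
    show "trop_exp (g y) = y" if "y \<in> topspace (top_of_set {0..})" for y
      using that by (auto simp: g_def e1 e2)
  qed
  then show ?thesis using homeomorphic_map_maps by blast
qed

lemma topspace_trop_chart: "topspace (trop_chart M \<sigma>) = trop_chart_points M \<sigma>"
  by (auto simp: trop_chart_def trop_numbers_def trop_chart_points_def)

lemma openin_trop_toric:
  fixes M :: "'a::euclidean_space set" and \<Sigma>
  defines "X \<equiv> sum_topology (trop_chart M) \<Sigma>"
  shows "openin (trop_toric M \<Sigma>) U \<longleftrightarrow>
           U \<subseteq> trop_class M \<Sigma> ` topspace X \<and>
           openin X {p \<in> topspace X. trop_class M \<Sigma> p \<in> U}"
proof -
  let ?P = "\<lambda>U. {p \<in> topspace X. trop_class M \<Sigma> p \<in> U}"
  have 1: "?P (S \<inter> T) = ?P S \<inter> ?P T" for S T by auto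
  have 2: "?P (\<Union>\<K>) = (\<Union>K\<in>\<K>. ?P K)" for \<K> by auto
  have "istopology (\<lambda>U. U \<subseteq> trop_class M \<Sigma> ` topspace X \<and> openin X (?P U))"
    unfolding istopology_def 1 2 by blast
  then show ?thesis by (simp add: trop_toric_def X_def[symmetric])
qed

lemma quotient_map_trop_class:
  "quotient_map (sum_topology (trop_chart M) \<Sigma>) (trop_toric M \<Sigma>) (trop_class M \<Sigma>)"
proof -
  let ?X = "sum_topology (trop_chart M) \<Sigma>"
  have "{p \<in> topspace ?X. trop_class M \<Sigma> p \<in> trop_class M \<Sigma> ` topspace ?X} = topspace ?X"
    by auto
  then have "openin (trop_toric M \<Sigma>) (trop_class M \<Sigma> ` topspace ?X)"
    unfolding openin_trop_toric by (simp only: openin_topspace simp_thms order_refl)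
  moreover have "topspace (trop_toric M \<Sigma>) \<subseteq> trop_class M \<Sigma> ` topspace ?X"
    using openin_topspace[of "trop_toric M \<Sigma>"] unfolding openin_trop_toric by (rule conjunct1)
  ultimately have "topspace (trop_toric M \<Sigma>) = trop_class M \<Sigma> ` topspace ?X"
    by (intro subset_antisym openin_subset)
  then show ?thesis
    by (simp add: quotient_map_def openin_trop_toric)
qed

text \<open>Every homomorphism \<open>M \<rightarrow> \<real>\<close> is pairing with a unique vector of the ambient space.\<close>

lemma hom_real_iff_inner:
  fixes f :: "'a::euclidean_space \<Rightarrow> real"
  assumes "full_lattice M"
  shows "(\<forall>u\<in>M. \<forall>u'\<in>M. f (u + u') = f u + f u') \<longleftrightarrow> (\<exists>!x. \<forall>u\<in>M. f u = x \<bullet> u)"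
proof
  obtain B where B: "independent B" "span B = UNIV"
    and M: "M = range (\<lambda>c :: 'a \<Rightarrow> int. \<Sum>b\<in>B. of_int (c b) *\<^sub>R b)"
    using assms unfolding full_lattice_def by blast
  have MI: "(\<Sum>b\<in>B. of_int (c b) *\<^sub>R b) \<in> M" for c :: "'a \<Rightarrow> int"
    unfolding M by blast
  have fin: "finite B" using B(1) by (rule independent_imp_finite)
  have add: "u + u' \<in> M" if "u \<in> M" "u' \<in> M" for u u'
  proof -
    obtain c c' :: "'a \<Rightarrow> int" where
      "u = (\<Sum>b\<in>B. of_int (c b) *\<^sub>R b)" "u' = (\<Sum>b\<in>B. of_int (c' b) *\<^sub>R b)"
      using \<open>u \<in> M\<close> \<open>u' \<in> M\<close> unfolding M by blast
    then have "u + u' = (\<Sum>b\<in>B. of_int (c b + c' b) *\<^sub>R b)"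
      by (simp add: scaleR_add_left sum.distrib)
    then show ?thesis using MI[of "\<lambda>b. c b + c' b"] by (simp only:)
  qed
  have basis: "b \<in> M" if "b \<in> B" for b
  proof -
    have "(\<Sum>b'\<in>B. of_int (if b' = b then 1 else 0) *\<^sub>R b') = (\<Sum>b'\<in>B. if b' = b then b' else 0)"
      by (intro sum.cong) auto
    then have "b = (\<Sum>b'\<in>B. of_int (if b' = b then 1 else 0) *\<^sub>R b')"
      using fin that by simp
    then show ?thesis using MI[of "\<lambda>b'. if b' = b then 1 else 0"] by (simp only:)
  qed
  {
    assume "\<exists>!x. \<forall>u\<in>M. f u = x \<bullet> u"
    then show "\<forall>u\<in>M. \<forall>u'\<in>M. f (u + u') = f u + f u'"
      using add by (auto simp: inner_add_right)
  next
    assume hom: "\<forall>u\<in>M. \<forall>u'\<in>M. f (u + u') = f u + f u'"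
    obtain g where g: "linear g" "\<And>b. b \<in> B \<Longrightarrow> g b = f b"
      using linear_independent_extend[OF B(1)] by blast
    define x where "x = (\<Sum>i\<in>Basis. g i *\<^sub>R i)"
    have gx: "g u = x \<bullet> u" for u
    proof -
      have "g u = g (\<Sum>i\<in>Basis. (u \<bullet> i) *\<^sub>R i)" by (simp add: euclidean_representation)
      also have "\<dots> = (\<Sum>i\<in>Basis. (u \<bullet> i) * g i)"
        using g(1) by (simp only: linear_sum linear_cmul real_scaleR_def)
      also have "\<dots> = u \<bullet> x"
        by (simp add: x_def inner_sum_right mult.commute)
      also have "\<dots> = x \<bullet> u"
        by (rule inner_commute)
      finally show ?thesis .
    qed
    have zero: "0 \<in> M"
      unfolding M by (rule image_eqI[where x = "\<lambda>_. 0"]) auto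
    have f0: "f 0 = 0" using hom zero by (metis add.right_neutral add_cancel_left_right)
    have M_sub: "of_int k *\<^sub>R b \<in> M" if "b \<in> B" for k :: int and b
    proof -
      have "(\<Sum>b'\<in>B. of_int (if b' = b then k else 0) *\<^sub>R b') = (\<Sum>b'\<in>B. if b' = b then of_int k *\<^sub>R b' else 0)"
        by (intro sum.cong) auto
      then have "of_int k *\<^sub>R b = (\<Sum>b'\<in>B. of_int (if b' = b then k else 0) *\<^sub>R b')"
        using fin that by simp
      then show ?thesis using MI[of "\<lambda>b'. if b' = b then k else 0"] by (simp only:)
    qed
    have mult: "f (of_int k *\<^sub>R b) = of_int k * f b" if "b \<in> B" for k :: int and b
    proof -
      have step: "f (of_int (k + 1) *\<^sub>R b) = f (of_int k *\<^sub>R b) + f b" for k :: int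
        using hom M_sub[OF that, of k] basis[OF that] by (simp add: scaleR_add_left)
      show ?thesis
      proof (induction k rule: int_induct[where k = 0])
        case base
        then show ?case by (simp add: f0)
      next
        case (step1 i)
        then show ?case using step[of i] by (simp add: algebra_simps)
      next
        case (step2 i)
        then show ?case using step[of "i - 1"] by (simp add: algebra_simps)
      qed
    qed
    have sums: "(\<Sum>b\<in>A. of_int (c b) *\<^sub>R b) \<in> M \<and>
        f (\<Sum>b\<in>A. of_int (c b) *\<^sub>R b) = (\<Sum>b\<in>A. of_int (c b) * f b)"
      if "A \<subseteq> B" for A and c :: "'a \<Rightarrow> int"
      using finite_subset[OF that fin] that
    proof (induction A rule: finite_induct)
      case empty
      then show ?case using zero f0 by simp
    next
      case (insert a A)
      then show ?case using M_sub[of a "c a"] mult[of a "c a"] add hom by auto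
    qed
    have ex: "\<forall>u\<in>M. f u = x \<bullet> u"
    proof
      fix u assume "u \<in> M"
      then obtain c :: "'a \<Rightarrow> int" where u: "u = (\<Sum>b\<in>B. of_int (c b) *\<^sub>R b)"
        unfolding M by blast
      have "f u = (\<Sum>b\<in>B. of_int (c b) * g b)" using sums[of B c] g(2) u by simp
      also have "\<dots> = g u" using g(1) by (simp add: u linear_sum linear_cmul)
      finally show "f u = x \<bullet> u" by (simp add: gx)
    qed
    moreover have "y = x" if "\<forall>u\<in>M. f u = y \<bullet> u" for y
    proof -
      have "(y - x) \<bullet> b = 0" if "b \<in> B" for b
        using ex \<open>\<forall>u\<in>M. f u = y \<bullet> u\<close> basis[OF that] by (simp add: inner_diff_left)
      then have "orthogonal (y - x) (y - x)"
        by (intro orthogonal_to_span[of "y - x" B]) (simp_all add: B(2) orthogonal_def)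
      then show ?thesis by (simp add: orthogonal_self)
    qed
    ultimately show "\<exists>!x. \<forall>u\<in>M. f u = x \<bullet> u" by blast
  }
qed

text \<open>The image of \<open>trop_embed\<close> is exactly the chart of the zero cone.\<close>

lemma range_trop_embed:
  assumes "full_lattice M"
  shows "range (trop_embed M \<Sigma>) = (\<lambda>\<phi>. trop_class M \<Sigma> ({0}, \<phi>)) ` trop_chart_points M {0}"
proof -
  obtain B where M: "M = range (\<lambda>c :: 'a \<Rightarrow> int. \<Sum>b\<in>B. of_int (c b) *\<^sub>R b)"
    using assms unfolding full_lattice_def by blast
  have MI: "(\<Sum>b\<in>B. of_int (c b) *\<^sub>R b) \<in> M" for c :: "'a \<Rightarrow> int"
    unfolding M by blast
  have zero: "0 \<in> M"
    unfolding M by (rule image_eqI[where x = "\<lambda>_. 0"]) auto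
  have neg: "- u \<in> M" if u: "u \<in> M" for u
  proof -
    obtain c :: "'a \<Rightarrow> int" where "u = (\<Sum>b\<in>B. of_int (c b) *\<^sub>R b)"
      using u unfolding M by blast
    then have "- u = (\<Sum>b\<in>B. of_int (- c b) *\<^sub>R b)"
      by (simp add: sum_negf)
    then show ?thesis using MI[of "\<lambda>b. - c b"] by (simp only:)
  qed
  have D: "dual_monoid M {0} = M" by (auto simp: dual_cone_def)
  have add: "u + u' \<in> M" if u: "u \<in> M" "u' \<in> M" for u u'
  proof -
    obtain c c' :: "'a \<Rightarrow> int" where
      "u = (\<Sum>b\<in>B. of_int (c b) *\<^sub>R b)" "u' = (\<Sum>b\<in>B. of_int (c' b) *\<^sub>R b)"
      using u unfolding M by blast
    then have "u + u' = (\<Sum>b\<in>B. of_int (c b + c' b) *\<^sub>R b)"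
      by (simp add: scaleR_add_left sum.distrib)
    then show ?thesis using MI[of "\<lambda>b. c b + c' b"] by (simp only:)
  qed
  have "trop_chart_points M {0} = range (\<lambda>x. restrict (\<lambda>u. ereal (x \<bullet> u)) M)"
  proof (intro equalityI subsetI)
    fix \<phi> assume phi: "\<phi> \<in> trop_chart_points M {0}"
    have finite_val: "\<phi> u = ereal (real_of_ereal (\<phi> u))" if u: "u \<in> M" for u
    proof -
      have "\<phi> u + \<phi> (- u) = 0"
        using phi neg[OF u] u unfolding trop_chart_points_def D
        by (metis (mono_tags, lifting) add.right_inverse mem_Collect_eq)
      then show ?thesis by (cases "\<phi> u"; cases "\<phi> (- u)") auto
    qed
    have "\<forall>u\<in>M. \<forall>u'\<in>M. real_of_ereal (\<phi> (u + u')) = real_of_ereal (\<phi> u) + real_of_ereal (\<phi> u')"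
    proof (intro ballI)
      fix u u' assume u: "u \<in> M" "u' \<in> M"
      have "\<phi> (u + u') = \<phi> u + \<phi> u'"
        using phi u unfolding trop_chart_points_def D by blast
      then show "real_of_ereal (\<phi> (u + u')) = real_of_ereal (\<phi> u) + real_of_ereal (\<phi> u')"
        using finite_val[OF u(1)] finite_val[OF u(2)]
        by (metis plus_ereal.simps(1) real_of_ereal.simps(1))
    qed
    then obtain x where x: "\<forall>u\<in>M. real_of_ereal (\<phi> u) = x \<bullet> u"
      using hom_real_iff_inner[OF assms, of "\<lambda>u. real_of_ereal (\<phi> u)"] by blast
    have "\<phi> \<in> extensional M"
      using phi unfolding trop_chart_points_def D by (auto simp: PiE_def)
    then have "\<phi> = restrict (\<lambda>u. ereal (x \<bullet> u)) M"
      using x finite_val by (intro extensionalityI[of _ M]) auto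
    then show "\<phi> \<in> range (\<lambda>x. restrict (\<lambda>u. ereal (x \<bullet> u)) M)" by blast
  next
    fix \<phi> assume "\<phi> \<in> range (\<lambda>x. restrict (\<lambda>u. ereal (x \<bullet> u)) M)"
    then show "\<phi> \<in> trop_chart_points M {0}"
      unfolding trop_chart_points_def D using zero add by (auto simp: inner_add_right)
  qed
  then show ?thesis by (auto simp: trop_embed_def)
qed

end

theory Submission
  imports Defs
begin

text \<open>
  A point \<open>w\<close> of the toric variety is the class of a homomorphism \<open>\<phi>\<close> in the chart of some cone
  \<open>\<sigma>\<close>. Let \<open>F\<close> and \<open>T\<close> be the sets of \<open>u\<close> in the dual monoid of \<open>\<sigma>\<close> at which \<open>\<phi>\<close> is finite and
  \<open>-\<infinity>\<close> respectively. A chart carries the topology of pointwise convergence, so \<open>w' + t v\<close> tends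
  to \<open>w\<close> as soon as \<open>w' \<bullet> u = \<phi> u\<close> and \<open>v \<bullet> u = 0\<close> on \<open>F\<close>, and \<open>v \<bullet> u < 0\<close> on \<open>T\<close>
  (\<open>limitin_trop_toric\<close>). That \<open>w\<close> is in the closure of \<open>L\<close> means that for finitely many elements
  of \<open>F\<close> and \<open>T\<close> there are points \<open>x\<close> of \<open>L\<close> with \<open>x \<bullet> u\<close> close to \<open>\<phi> u\<close> on the former and very
  negative on the latter. Three things lead from the second situation to the first.

  Polyhedra (\<open>polyhedron_point_and_direction\<close>): approximate solutions of finitely many such
  conditions in \<open>L\<close> yield a point of \<open>L\<close> that solves the equations exactly, and a recession
  direction along which the equations persist and the negative functionals decrease. In terms of
  linear maps, the image of a polyhedron is closed, and a functional that is unbounded below on a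
  polyhedron is negative on a recession direction. Both hold because a sequence of solutions of
  least norm cannot go to infinity in a direction along which it could be pulled back.

  Finiteness (\<open>point_and_direction_for_chart_point\<close>): on \<open>F\<close>, a linear basis of the span of \<open>F\<close>
  suffices. On \<open>T\<close>, Dickson's lemma gives a finite \<open>G \<subseteq> T\<close> such that every element of \<open>T\<close> is the
  sum of one of \<open>G\<close> and one of the dual monoid; if \<open>v\<close> vanishes on \<open>F\<close> and is negative on \<open>G\<close>, then
  by induction on the height of \<open>u\<close> it is negative on all of \<open>T\<close>.

  Gluing (\<open>chart_closure\<close>): closure in the quotient implies closure in the chart of \<open>\<sigma>\<close>. The
  image of an open set of that chart is open, because the chart of a face \<open>\<tau>\<close> of \<open>\<rho>\<close> is the open
  part of the chart of \<open>\<rho>\<close> where \<open>\<phi> m\<close> is finite, for an \<open>m\<close> in the dual monoid of \<open>\<rho>\<close> that cuts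
  out \<open>\<tau>\<close>. Dirichlet's simultaneous approximation makes a real supporting functional integral.
\<close>

section \<open>Polyhedra and recession directions\<close>

definition solutions :: "('a::euclidean_space \<times> real) set \<Rightarrow> 'a set" where
  "solutions H = {x. \<forall>(a, b)\<in>H. a \<bullet> x \<le> b}"

lemma solutions_Un: "solutions (H \<union> K) = solutions H \<inter> solutions K"
  by (auto simp: solutions_def)

lemma closed_solutions: "closed (solutions H)"
proof -
  have "solutions H = (\<Inter>(a, b)\<in>H. {x. a \<bullet> x \<le> b})"
    by (auto simp: solutions_def)
  then show ?thesis
    by (auto intro!: closed_INT closed_halfspace_le)
qed

lemma polyhedron_solutions:
  assumes "polyhedron L"
  obtains H where "finite H" "L = solutions H"
proof -
  obtain F where F: "finite F" "L = \<Inter>F" "\<forall>h\<in>F. \<exists>a b. a \<noteq> 0 \<and> h = {x. a \<bullet> x \<le> b}"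
    using assms unfolding polyhedron_def by (elim exE conjE)
  from bchoice[OF F(3)] obtain a where "\<forall>h\<in>F. \<exists>b. a h \<noteq> 0 \<and> h = {x. a h \<bullet> x \<le> b}" ..
  from bchoice[OF this] obtain b where ab: "\<forall>h\<in>F. a h \<noteq> 0 \<and> h = {x. a h \<bullet> x \<le> b h}" ..
  have "x \<in> h \<longleftrightarrow> a h \<bullet> x \<le> b h" if "h \<in> F" for x h
  proof -
    have "h = {x. a h \<bullet> x \<le> b h}" using ab[rule_format, OF that] by (rule conjunct2)
    then have "x \<in> h \<longleftrightarrow> x \<in> {x. a h \<bullet> x \<le> b h}" by (rule arg_cong)
    then show ?thesis by simp
  qed
  then have "L = solutions ((\<lambda>h. (a h, b h)) ` F)"
    by (auto simp: F(2) solutions_def)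
  from that[OF finite_imageI[OF F(1)] this] show thesis .
qed

lemma recession_cone_solutions:
  assumes "\<forall>(a, b)\<in>H. a \<bullet> v \<le> 0"
  shows "v \<in> recession_cone (solutions H)"
  using assms by (fastforce simp: recession_cone_def solutions_def inner_add_right)

text \<open>
  Since the direction \<open>v\<close> is a limit of \<open>X n / norm (X n)\<close>, an inequality of \<open>H\<close> is either constant
  along \<open>v\<close> or becomes arbitrarily slack along the sequence. So the points can eventually be moved
  back by \<open>v\<close>, and this brings them closer to the origin. It is applied to points of least norm,
  where it gives a contradiction.
\<close>

lemma solutions_escape:
  fixes X :: "nat \<Rightarrow> 'a::euclidean_space"
  assumes H: "finite H" and X: "\<And>n. X n \<in> solutions H"
    and inf: "filterlim (\<lambda>n. norm (X n)) at_top sequentially"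
  obtains r v where "strict_mono r" "(\<lambda>n. X (r n) /\<^sub>R norm (X (r n))) \<longlonglongrightarrow> v"
    "\<forall>(a, b)\<in>H. a \<bullet> v \<le> 0"
    "\<forall>\<^sub>F n in sequentially. X (r n) - v \<in> solutions H \<and> norm (X (r n) - v) < norm (X (r n))"
proof -
  have "norm (x /\<^sub>R norm x) \<le> 1" for x :: 'a
    by (cases "x = 0") simp_all
  then have "bounded (range (\<lambda>n. X n /\<^sub>R norm (X n)))"
    by (intro boundedI[of _ 1]) auto
  then obtain v r where r: "strict_mono (r :: nat \<Rightarrow> nat)"
    and "((\<lambda>n. X n /\<^sub>R norm (X n)) \<circ> r) \<longlonglongrightarrow> v"
    using bounded_imp_convergent_subsequence by blast
  then have lim: "(\<lambda>n. X (r n) /\<^sub>R norm (X (r n))) \<longlonglongrightarrow> v" by (simp add: o_def)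
  have inf': "filterlim (\<lambda>n. norm (X (r n))) at_top sequentially"
    using filterlim_compose[OF inf filterlim_subseq[OF r]] .
  have pos: "\<forall>\<^sub>F n in sequentially. norm (X (r n)) > 0"
    using inf' unfolding filterlim_at_top_dense by blast
  have lim_inner: "(\<lambda>n. (a \<bullet> X (r n)) / norm (X (r n))) \<longlonglongrightarrow> a \<bullet> v" for a
    using tendsto_inner[OF tendsto_const lim, of a] by (simp add: divide_inverse mult.commute)
  have rec: "a \<bullet> v \<le> 0" if "(a, b) \<in> H" for a b
  proof (rule tendsto_le[OF sequentially_bot _ lim_inner])
    show "(\<lambda>n. b / norm (X (r n))) \<longlonglongrightarrow> 0"
      by (rule real_tendsto_divide_at_top[OF tendsto_const inf'])
    show "\<forall>\<^sub>F n in sequentially. (a \<bullet> X (r n)) / norm (X (r n)) \<le> b / norm (X (r n))"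
      using pos
    proof eventually_elim
      case (elim n)
      have "a \<bullet> X (r n) \<le> b" using X[of "r n"] that by (auto simp: solutions_def)
      then show ?case by (simp add: divide_right_mono)
    qed
  qed
  have to_inf: "filterlim (\<lambda>n. c \<bullet> X (r n)) at_top sequentially" if "c \<bullet> v > 0" for c
  proof -
    have "filterlim (\<lambda>n. ((c \<bullet> X (r n)) / norm (X (r n))) * norm (X (r n))) at_top sequentially"
      using filterlim_tendsto_pos_mult_at_top[OF lim_inner that inf'] .
    then show ?thesis
      by (rule filterlim_cong[THEN iffD1, rotated 3]) (use pos in \<open>auto elim: eventually_mono\<close>)
  qed
  have "\<forall>\<^sub>F n in sequentially. a \<bullet> (X (r n) - v) \<le> b" if ab: "(a, b) \<in> H" for a b
  proof (cases "a \<bullet> v = 0")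
    case True
    have "a \<bullet> X n \<le> b" for n using X[of n] ab by (auto simp: solutions_def)
    with True show ?thesis by (simp add: inner_diff_right)
  next
    case False
    then have "(- a) \<bullet> v > 0" using rec[OF ab] by simp
    from to_inf[OF this] have "\<forall>\<^sub>F n in sequentially. (- a) \<bullet> X (r n) \<ge> - (a \<bullet> v) - b"
      unfolding filterlim_at_top by blast
    then show ?thesis
      by eventually_elim (simp add: inner_diff_right)
  qed
  then have stay: "\<forall>\<^sub>F n in sequentially. X (r n) - v \<in> solutions H"
    using H by (simp add: solutions_def eventually_ball_finite_distrib split_beta)
  have "norm v = 1"
  proof (rule LIMSEQ_unique[OF tendsto_norm[OF lim]])
    show "(\<lambda>n. norm (X (r n) /\<^sub>R norm (X (r n)))) \<longlonglongrightarrow> 1"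
      by (rule tendsto_eventually) (use pos in \<open>auto elim: eventually_mono\<close>)
  qed
  then have vv: "v \<bullet> v = 1" by (simp add: dot_square_norm)
  then have "\<forall>\<^sub>F n in sequentially. v \<bullet> X (r n) \<ge> 1"
    using to_inf[of v] unfolding filterlim_at_top by simp
  then have closer: "\<forall>\<^sub>F n in sequentially. norm (X (r n) - v) < norm (X (r n))"
  proof eventually_elim
    case (elim n)
    then have "(X (r n) - v) \<bullet> (X (r n) - v) < X (r n) \<bullet> X (r n)"
      by (simp add: inner_diff_left inner_diff_right vv inner_commute)
    then show ?case by (simp add: norm_lt)
  qed
  show thesis
    using that[OF r lim _ eventually_conj[OF stay closer]] rec by blast
qed

lemma solutions_minimal_norm:
  assumes "solutions H \<noteq> {}"
  obtains x where "x \<in> solutions H" "\<And>y. y \<in> solutions H \<Longrightarrow> norm x \<le> norm y"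
  using distance_attains_inf[OF closed_solutions assms, of 0] by auto

definition equations :: "'a::euclidean_space set \<Rightarrow> ('a \<Rightarrow> real) \<Rightarrow> ('a \<times> real) set" where
  "equations A c = (\<lambda>a. (a, c a)) ` A \<union> (\<lambda>a. (- a, - c a)) ` A"

lemma solutions_equations: "solutions (equations A c) = {x. \<forall>a\<in>A. a \<bullet> x = c a}"
  by (auto simp: solutions_def equations_def ball_Un order_antisym)

text \<open>
  Closedness of the image of a polyhedron under \<open>x \<mapsto> (a \<bullet> x)\<^sub>a\<close>. Points with almost the right values
  are replaced by the points of least norm with these same values. They have a bounded subsequence:
  an escape direction would be orthogonal to \<open>A\<close>, so moving back along it would keep the values and
  lower the norm.
\<close>

lemma approximate_solutions:
  assumes H: "finite H" and A: "finite A"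
    and approx: "\<And>e. e > 0 \<Longrightarrow> \<exists>x\<in>solutions H. \<forall>a\<in>A. \<bar>a \<bullet> x - c a\<bar> < e"
  shows "\<exists>x\<in>solutions H. \<forall>a\<in>A. a \<bullet> x = c a"
proof -
  have "\<forall>n. \<exists>x. x \<in> solutions H \<and> (\<forall>a\<in>A. \<bar>a \<bullet> x - c a\<bar> < inverse (real (Suc n))) \<and>
      (\<forall>y\<in>solutions H. (\<forall>a\<in>A. a \<bullet> y = a \<bullet> x) \<longrightarrow> norm x \<le> norm y)"
  proof
    fix n :: nat
    obtain z where z: "z \<in> solutions H" "\<forall>a\<in>A. \<bar>a \<bullet> z - c a\<bar> < inverse (real (Suc n))"
      using approx[of "inverse (real (Suc n))"] by auto
    let ?K = "H \<union> equations A (\<lambda>a. a \<bullet> z)"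
    have K: "solutions ?K = {x \<in> solutions H. \<forall>a\<in>A. a \<bullet> x = a \<bullet> z}"
      by (auto simp: solutions_Un solutions_equations)
    then have "solutions ?K \<noteq> {}" using z(1) by auto
    then obtain x where "x \<in> solutions ?K" "\<And>y. y \<in> solutions ?K \<Longrightarrow> norm x \<le> norm y"
      using solutions_minimal_norm by blast
    then show "\<exists>x. x \<in> solutions H \<and> (\<forall>a\<in>A. \<bar>a \<bullet> x - c a\<bar> < inverse (real (Suc n))) \<and>
        (\<forall>y\<in>solutions H. (\<forall>a\<in>A. a \<bullet> y = a \<bullet> x) \<longrightarrow> norm x \<le> norm y)"
      using z(2) unfolding K by (intro exI[of _ x]) auto
  qed
  from choice[OF this]
  obtain X where X: "\<And>n. X n \<in> solutions H"
      and Xc: "\<And>n a. a \<in> A \<Longrightarrow> \<bar>a \<bullet> X n - c a\<bar> < inverse (real (Suc n))"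
      and Xmin: "\<And>n y. y \<in> solutions H \<Longrightarrow> \<forall>a\<in>A. a \<bullet> y = a \<bullet> X n \<Longrightarrow> norm (X n) \<le> norm y"
    by blast
  have lim: "(\<lambda>n. a \<bullet> X n) \<longlonglongrightarrow> c a" if "a \<in> A" for a
  proof (rule Lim_null_comparison[THEN LIM_zero_cancel])
    show "\<forall>\<^sub>F n in sequentially. norm (a \<bullet> X n - c a) \<le> inverse (real (Suc n))"
      using Xc[OF that] by (intro always_eventually) (simp add: less_imp_le)
    show "(\<lambda>n. inverse (real (Suc n))) \<longlonglongrightarrow> 0"
      by (rule LIMSEQ_inverse_real_of_nat)
  qed
  show ?thesis
  proof (cases "filterlim (\<lambda>n. norm (X n)) at_top sequentially")
    case True
    obtain r v where r: "strict_mono r" "(\<lambda>n. X (r n) /\<^sub>R norm (X (r n))) \<longlonglongrightarrow> v"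
        "\<forall>(a, b)\<in>H. a \<bullet> v \<le> 0"
      and ev: "\<forall>\<^sub>F n in sequentially. X (r n) - v \<in> solutions H \<and> norm (X (r n) - v) < norm (X (r n))"
      using solutions_escape[OF H X True] .
    have inf': "filterlim (\<lambda>n. norm (X (r n))) at_top sequentially"
      using filterlim_compose[OF True filterlim_subseq[OF r(1)]] .
    have "a \<bullet> v = 0" if "a \<in> A" for a
    proof (rule LIMSEQ_unique)
      show "(\<lambda>n. (a \<bullet> X (r n)) / norm (X (r n))) \<longlonglongrightarrow> a \<bullet> v"
        using tendsto_inner[OF tendsto_const r(2), of a] by (simp add: divide_inverse mult.commute)
      show "(\<lambda>n. (a \<bullet> X (r n)) / norm (X (r n))) \<longlonglongrightarrow> 0"
        using LIMSEQ_subseq_LIMSEQ[OF lim[OF that] r(1)] inf'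
        by (intro real_tendsto_divide_at_top) (simp_all add: o_def)
    qed
    moreover obtain n where "X (r n) - v \<in> solutions H" "norm (X (r n) - v) < norm (X (r n))"
      using eventually_happens[OF ev] by auto
    ultimately show ?thesis
      using Xmin[of "X (r n) - v" "r n"] by (simp add: inner_diff_right)
  next
    case False
    then obtain K where K: "\<exists>\<^sub>F n in sequentially. norm (X n) < K"
      unfolding filterlim_at_top by (auto simp: frequently_def not_less)
    then have inf: "infinite {n. norm (X n) < K}"
      by (simp add: frequently_cofinite flip: cofinite_eq_sequentially)
    define s where "s = enumerate {n. norm (X n) < K}"
    have s: "strict_mono s" "\<And>n. norm (X (s n)) < K"
      using strict_mono_enumerate[OF inf] enumerate_in_set[OF inf] by (auto simp: s_def)
    have "bounded (range (\<lambda>n. X (s n)))"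
      using s(2) by (intro boundedI[of _ K]) (auto intro: less_imp_le)
    then obtain x r where r: "strict_mono (r :: nat \<Rightarrow> nat)" "((\<lambda>n. X (s n)) \<circ> r) \<longlonglongrightarrow> x"
      using bounded_imp_convergent_subsequence by blast
    have sr: "strict_mono (s \<circ> r)" using s(1) r(1) by (rule strict_mono_o)
    have x: "x \<in> solutions H"
      using closed_sequentially[OF closed_solutions _ r(2)] X by simp
    moreover have "a \<bullet> x = c a" if "a \<in> A" for a
      using tendsto_inner[OF tendsto_const r(2), of a] LIMSEQ_subseq_LIMSEQ[OF lim[OF that] sr]
      by (auto simp: o_def intro: LIMSEQ_unique)
    ultimately show ?thesis by blast
  qed
qed

text \<open>
  Let \<open>X n\<close> be the solution of least norm with \<open>g \<bullet> X n \<le> - n\<close>. An escape direction \<open>v\<close> satisfies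
  \<open>g \<bullet> v \<le> 0\<close>, and \<open>g \<bullet> v = 0\<close> is impossible, since then \<open>X n - v\<close> would be a competitor of smaller
  norm.
\<close>

lemma unbounded_below_direction:
  fixes g :: "'a::euclidean_space"
  assumes H: "finite H" and low: "\<And>K. \<exists>x\<in>solutions H. g \<bullet> x \<le> - K"
  shows "\<exists>v. (\<forall>(a, b)\<in>H. a \<bullet> v \<le> 0) \<and> g \<bullet> v < 0"
proof -
  have "\<exists>x. x \<in> solutions (insert (g, - real n) H) \<and>
      (\<forall>y\<in>solutions (insert (g, - real n) H). norm x \<le> norm y)" for n
  proof -
    have "solutions (insert (g, - real n) H) \<noteq> {}"
      using low[of "real n"] by (auto simp: solutions_def)
    then show ?thesis using solutions_minimal_norm by metis
  qed
  then obtain X where X: "\<And>n. X n \<in> solutions (insert (g, - real n) H)"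
      and Xmin: "\<And>n y. y \<in> solutions (insert (g, - real n) H) \<Longrightarrow> norm (X n) \<le> norm y"
    by metis
  have XH: "X n \<in> solutions H" and Xg: "real n \<le> - (g \<bullet> X n)" for n
    using X[of n] by (auto simp: solutions_def)
  have "filterlim (\<lambda>n. norm g * norm (X n)) at_top sequentially"
  proof (rule filterlim_at_top_mono[OF filterlim_real_sequentially always_eventually], rule allI)
    show "real n \<le> norm g * norm (X n)" for n
      using Xg[of n] Cauchy_Schwarz_ineq2[of g "X n"] by linarith
  qed
  moreover have "norm g > 0" using Xg[of 1] by (cases "g = 0") auto
  ultimately have inf: "filterlim (\<lambda>n. norm (X n)) at_top sequentially"
    using filterlim_tendsto_pos_mult_at_top_iff[of "\<lambda>_. norm g" "norm g"] by auto
  \<comment> \<open>The inequality \<open>g \<bullet> x \<le> 0\<close> is added to obtain \<open>g \<bullet> v \<le> 0\<close>.\<close>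
  have X0: "X n \<in> solutions (insert (g, 0) H)" for n
    using XH[of n] Xg[of n] by (auto simp: solutions_def)
  have finH: "finite (insert (g, 0) H)" using H by simp
  obtain r v where r: "strict_mono r" "(\<lambda>n. X (r n) /\<^sub>R norm (X (r n))) \<longlonglongrightarrow> v"
      "\<forall>(a, b)\<in>insert (g, 0) H. a \<bullet> v \<le> 0"
    and ev: "\<forall>\<^sub>F n in sequentially. X (r n) - v \<in> solutions (insert (g, 0) H)
        \<and> norm (X (r n) - v) < norm (X (r n))"
    using solutions_escape[OF finH X0 inf] .
  obtain n where n: "X (r n) - v \<in> solutions (insert (g, 0) H)" "norm (X (r n) - v) < norm (X (r n))"
    using eventually_happens[OF ev] by auto
  have "g \<bullet> v \<noteq> 0"
  proof
    assume "g \<bullet> v = 0"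
    then have "X (r n) - v \<in> solutions (insert (g, - real (r n)) H)"
      using n(1) Xg[of "r n"] by (auto simp: solutions_def inner_diff_right)
    then show False using Xmin n(2) by fastforce
  qed
  then show ?thesis using r(3) by (intro exI[of _ v]) auto
qed

text \<open>
  The directions are found for one \<open>g\<close> at a time, inside the polyhedron cut out of \<open>L\<close> by the
  equations and by \<open>h \<bullet> x \<le> 0\<close> for all \<open>h\<close> in \<open>G\<close>: there \<open>g\<close> is unbounded below, and the recession
  directions are nonpositive on the rest of \<open>G\<close>. The sum of these directions is negative on every
  element of \<open>G\<close>.
\<close>

lemma polyhedron_point_and_direction:
  fixes L :: "'a::euclidean_space set"
  assumes "polyhedron L" and A: "finite A" and G: "finite G"
    and approx: "\<And>e K. e > 0 \<Longrightarrow> \<exists>x\<in>L. (\<forall>a\<in>A. \<bar>a \<bullet> x - c a\<bar> < e) \<and> (\<forall>g\<in>G. g \<bullet> x \<le> - K)"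
  shows "\<exists>w\<in>L. \<exists>v\<in>recession_cone L.
    (\<forall>a\<in>A. a \<bullet> w = c a \<and> a \<bullet> v = 0) \<and> (\<forall>g\<in>G. g \<bullet> v < 0)"
proof -
  obtain H where H: "finite H" "L = solutions H"
    using polyhedron_solutions[OF assms(1)] .
  have exact: "\<exists>x\<in>L. (\<forall>a\<in>A. a \<bullet> x = c a) \<and> (\<forall>g\<in>G. g \<bullet> x \<le> - K)" for K
  proof -
    let ?H = "H \<union> (\<lambda>g. (g, - K)) ` G"
    have *: "solutions ?H = {x \<in> L. \<forall>g\<in>G. g \<bullet> x \<le> - K}"
      by (auto simp: H(2) solutions_def)
    have "\<exists>x\<in>solutions ?H. \<forall>a\<in>A. a \<bullet> x = c a"
    proof (rule approximate_solutions)
      show "\<exists>x\<in>solutions ?H. \<forall>a\<in>A. \<bar>a \<bullet> x - c a\<bar> < e" if "e > 0" for e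
        using approx[OF that, of K] unfolding * by blast
    qed (use H(1) A G in auto)
    then show ?thesis unfolding * by blast
  qed
  let ?H = "H \<union> equations A c \<union> (\<lambda>g. (g, 0)) ` G"
  have fin: "finite ?H" using H(1) A G by (simp add: equations_def)
  have "\<exists>v. (\<forall>(a, b)\<in>?H. a \<bullet> v \<le> 0) \<and> g \<bullet> v < 0" if g: "g \<in> G" for g
  proof (rule unbounded_below_direction[OF fin])
    fix K :: real
    obtain x where x: "x \<in> L" "\<forall>a\<in>A. a \<bullet> x = c a" "\<forall>g\<in>G. g \<bullet> x \<le> - max K 0"
      using exact by blast
    then have low: "h \<bullet> x \<le> 0" "h \<bullet> x \<le> - K" if "h \<in> G" for h
      using that by force+
    with x have "x \<in> solutions ?H"
      unfolding solutions_Un solutions_equations H(2) by (auto simp: solutions_def)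
    with low(2)[OF g] show "\<exists>x\<in>solutions ?H. g \<bullet> x \<le> - K" by blast
  qed
  then obtain v where v: "\<And>g. g \<in> G \<Longrightarrow> \<forall>(a, b)\<in>?H. a \<bullet> v g \<le> 0" "\<And>g. g \<in> G \<Longrightarrow> g \<bullet> v g < 0"
    by metis
  define u where "u = sum v G"
  have vH: "a \<bullet> v g \<le> 0" if "(a, b) \<in> ?H" "g \<in> G" for a b g
    using v(1)[OF that(2)] that(1) by blast
  have "a \<bullet> u \<le> 0" if "(a, b) \<in> ?H" for a b
    unfolding u_def inner_sum_right by (rule sum_nonpos) (rule vH[OF that])
  note uH = this
  have rec: "u \<in> recession_cone L"
    unfolding H(2) by (rule recession_cone_solutions) (use uH in blast)
  have Au: "a \<bullet> u = 0" if "a \<in> A" for a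
    using uH[of a "c a"] uH[of "- a" "- c a"] that by (simp add: equations_def)
  have "g \<bullet> u < 0" if g: "g \<in> G" for g
  proof -
    have "(\<Sum>h\<in>G - {g}. g \<bullet> v h) \<le> 0"
      using g by (intro sum_nonpos vH[of g 0]) auto
    then show ?thesis
      using v(2)[OF g] sum.remove[OF G g, of "\<lambda>h. g \<bullet> v h"] by (simp add: u_def inner_sum_right)
  qed
  note neg = this
  obtain w where "w \<in> L" "\<forall>a\<in>A. a \<bullet> w = c a" using exact[of 0] by blast
  with rec Au neg show ?thesis by (intro bexI[of _ w] bexI[of _ u] conjI ballI) simp_all
qed

section \<open>Integral supporting functionals of rational cones\<close>

lemma lattice_closed:
  assumes "full_lattice M"
  shows lattice_0: "0 \<in> M"
    and lattice_add: "\<And>u u'. u \<in> M \<Longrightarrow> u' \<in> M \<Longrightarrow> u + u' \<in> M"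
    and lattice_minus: "\<And>u. u \<in> M \<Longrightarrow> - u \<in> M"
proof -
  obtain B where M: "M = range (\<lambda>c :: 'a \<Rightarrow> int. \<Sum>b\<in>B. of_int (c b) *\<^sub>R b)"
    using assms unfolding full_lattice_def by blast
  have MI: "(\<Sum>b\<in>B. of_int (c b) *\<^sub>R b) \<in> M" for c :: "'a \<Rightarrow> int"
    unfolding M by blast
  show "0 \<in> M" using MI[of "\<lambda>_. 0"] by simp
  show "u + u' \<in> M" if u: "u \<in> M" "u' \<in> M" for u u'
  proof -
    obtain c c' :: "'a \<Rightarrow> int" where
      "u = (\<Sum>b\<in>B. of_int (c b) *\<^sub>R b)" "u' = (\<Sum>b\<in>B. of_int (c' b) *\<^sub>R b)"
      using u unfolding M by blast
    then show ?thesis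
      using MI[of "\<lambda>b. c b + c' b"] by (simp add: scaleR_add_left sum.distrib)
  qed
  show "- u \<in> M" if u: "u \<in> M" for u
  proof -
    obtain c :: "'a \<Rightarrow> int" where "u = (\<Sum>b\<in>B. of_int (c b) *\<^sub>R b)"
      using u unfolding M by blast
    then show ?thesis
      using MI[of "\<lambda>b. - c b"] by (simp add: sum_negf)
  qed
qed

lemma lattice_scaleR_nat:
  assumes "full_lattice M" "m \<in> M"
  shows "real k *\<^sub>R m \<in> M"
  by (induction k) (use assms lattice_0 lattice_add in \<open>auto simp: scaleR_add_left\<close>)

text \<open>
  Dirichlet's simultaneous approximation, applied to the coordinates of \<open>a\<close> in a lattice basis.
\<close>

lemma lattice_multiple_close:
  fixes M :: "'a::euclidean_space set"
  assumes M: "full_lattice M" and e: "e > 0"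
  obtains q :: int and m where "q > 0" "m \<in> M" "norm (of_int q *\<^sub>R a - m) < e"
proof -
  obtain B where B: "independent B" "span B = UNIV"
    and MB: "M = range (\<lambda>c :: 'a \<Rightarrow> int. \<Sum>b\<in>B. of_int (c b) *\<^sub>R b)"
    using M unfolding full_lattice_def by blast
  have fin: "finite B" using B(1) by (rule independent_imp_finite)
  obtain c where c: "a = (\<Sum>b\<in>B. c b *\<^sub>R b)"
    using B(2) span_finite[OF fin] by blast
  obtain h where h: "bij_betw h {..<card B} B"
    using ex_bij_betw_nat_finite[OF fin] by (auto simp: atLeast0LessThan)
  \<comment> \<open>The summand 1 makes \<open>C\<close> positive and an inequality below strict.\<close>
  define C where "C = (\<Sum>b\<in>B. norm b) + 1"
  have C: "C > 0" unfolding C_def by (simp add: add_nonneg_pos sum_nonneg)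
  obtain N :: nat where N: "N > 0" "C / e < N"
    using reals_Archimedean2[of "max (C / e) 0"] by (metis max_less_iff_conj of_nat_0_less_iff)
  obtain q p where q: "0 < q"
    and p: "\<And>i. i < card B \<Longrightarrow> \<bar>of_int q * c (h i) - of_int (p i)\<bar> < 1 / N"
    using Dirichlet_approx_simult[OF N(1), of "card B" "\<lambda>i. c (h i)"] by metis
  define p' where "p' = (\<lambda>b. p (inv_into {..<card B} h b))"
  have p': "\<bar>of_int q * c b - of_int (p' b)\<bar> \<le> 1 / N" if "b \<in> B" for b
  proof -
    have "inv_into {..<card B} h b < card B" "h (inv_into {..<card B} h b) = b"
      using bij_betwE[OF bij_betw_inv_into[OF h]] bij_betw_inv_into_right[OF h] that by auto
    then show ?thesis
      using p[of "inv_into {..<card B} h b"] by (simp add: p'_def)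
  qed
  define m where "m = (\<Sum>b\<in>B. of_int (p' b) *\<^sub>R b)"
  have "of_int q *\<^sub>R a - m = (\<Sum>b\<in>B. (of_int q * c b - of_int (p' b)) *\<^sub>R b)"
    by (simp add: c m_def scaleR_sum_right sum_subtractf scaleR_diff_left)
  also have "norm \<dots> \<le> (\<Sum>b\<in>B. (1 / N) * norm b)"
    using mult_right_mono[OF p' norm_ge_zero] by (intro sum_norm_le) simp
  also have "\<dots> < C / N"
    using N(1) by (simp add: C_def sum_divide_distrib[symmetric] divide_strict_right_mono)
  also have "\<dots> < e"
    using N e C by (simp add: field_simps)
  finally show thesis
    using that[of q m] q by (auto simp: m_def MB)
qed

lemma sgn_eq_if_near:
  fixes x y :: real
  assumes "\<bar>y - x\<bar> < \<bar>y\<bar>"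
  shows "sgn x = sgn y"
  using assms by (cases "y > 0") (auto simp: sgn_real_def)

text \<open>
  Take \<open>m\<close> in the lattice very close to a positive multiple of \<open>a\<close>. The numbers \<open>s \<bullet> m\<close> are integers,
  so those that are less than 1 in absolute value vanish; hence also the zeros of \<open>a\<close> on \<open>S\<close>
  are zeros of \<open>m\<close>.
\<close>

lemma integral_functional_same_signs:
  fixes M :: "'a::euclidean_space set"
  assumes M: "full_lattice M" and S: "finite S" "S \<subseteq> dual_lattice M"
  obtains m where "m \<in> M" "\<And>s. s \<in> S \<Longrightarrow> sgn (s \<bullet> m) = sgn (s \<bullet> a)"
proof -
  have "\<exists>d>0. \<forall>s\<in>S. norm s * d < 1 \<and> (s \<bullet> a \<noteq> 0 \<longrightarrow> norm s * d < \<bar>s \<bullet> a\<bar>)"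
  proof -
    have small: "\<forall>\<^sub>F d in at_right 0. norm s * d < c" if "c > 0" for c and s :: 'a
    proof (rule order_tendstoD)
      show "((\<lambda>d. norm s * d) \<longlongrightarrow> 0) (at_right 0)"
        by (auto intro!: tendsto_eq_intros)
    qed (rule that)
    have "\<forall>\<^sub>F d in at_right 0. d > 0 \<and>
        (\<forall>s\<in>S. norm s * d < 1 \<and> norm s * d < (if s \<bullet> a = 0 then 1 else \<bar>s \<bullet> a\<bar>))"
      by (intro eventually_conj eventually_ball_finite S(1) ballI small eventually_at_right_less) auto
    then obtain d where "d > 0 \<and>
        (\<forall>s\<in>S. norm s * d < 1 \<and> norm s * d < (if s \<bullet> a = 0 then 1 else \<bar>s \<bullet> a\<bar>))"
      using eventually_happens' trivial_limit_at_right_real by blast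
    then show ?thesis by (intro exI[of _ d]) auto
  qed
  then obtain d where d: "d > 0" "\<And>s. s \<in> S \<Longrightarrow> norm s * d < 1"
      "\<And>s. s \<in> S \<Longrightarrow> s \<bullet> a \<noteq> 0 \<Longrightarrow> norm s * d < \<bar>s \<bullet> a\<bar>"
    by blast
  obtain q :: int and m where q: "q > 0" and m: "m \<in> M" "norm (of_int q *\<^sub>R a - m) < d"
    using lattice_multiple_close[OF M d(1)] .
  have "sgn (s \<bullet> m) = sgn (s \<bullet> a)" if s: "s \<in> S" for s
  proof -
    have "\<bar>of_int q * (s \<bullet> a) - s \<bullet> m\<bar> \<le> norm s * norm (of_int q *\<^sub>R a - m)"
      using Cauchy_Schwarz_ineq2[of s "of_int q *\<^sub>R a - m"] by (simp add: inner_diff_right)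
    also have "\<dots> \<le> norm s * d" using m(2) by (simp add: mult_left_mono)
    finally have near: "\<bar>of_int q * (s \<bullet> a) - s \<bullet> m\<bar> \<le> norm s * d" .
    show ?thesis
    proof (cases "s \<bullet> a = 0")
      case True
      then have "\<bar>s \<bullet> m\<bar> < 1" using near d(2)[OF s] by simp
      moreover have "s \<bullet> m \<in> \<int>" using S(2) s m(1) by (auto simp: dual_lattice_def)
      ultimately have "s \<bullet> m = 0" by (intro Ints_nonzero_abs_less1)
      with True show ?thesis by simp
    next
      case False
      have "1 * \<bar>s \<bullet> a\<bar> \<le> of_int q * \<bar>s \<bullet> a\<bar>"
        using q by (intro mult_right_mono) auto
      then have "\<bar>of_int q * (s \<bullet> a) - s \<bullet> m\<bar> < \<bar>of_int q * (s \<bullet> a)\<bar>"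
        using near d(3)[OF s False] q by (simp add: abs_mult)
      then have "sgn (s \<bullet> m) = sgn (of_int q * (s \<bullet> a))"
        by (rule sgn_eq_if_near)
      with q show ?thesis by (simp add: sgn_mult)
    qed
  qed
  from that[OF m(1) this] show thesis .
qed

lemma dual_cone_convex_cone_hull: "dual_cone (convex_cone hull S) = {u. \<forall>s\<in>S. s \<bullet> u \<le> 0}"
proof -
  have "convex_cone hull S \<subseteq> {v. u \<bullet> v \<le> 0}" if "\<forall>s\<in>S. s \<bullet> u \<le> 0" for u
    using that by (intro hull_minimal convex_cone_halfspace_le) (auto simp: inner_commute)
  then show ?thesis
    by (auto simp: dual_cone_def inner_commute hull_inc)
qed

lemma dual_cone_antimono: "\<tau> \<subseteq> \<sigma> \<Longrightarrow> dual_cone \<sigma> \<subseteq> dual_cone \<tau>"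
  by (auto simp: dual_cone_def)

lemma dual_monoid_closed:
  assumes "full_lattice M"
  shows dual_monoid_0: "0 \<in> dual_monoid M \<sigma>"
    and dual_monoid_add: "\<And>u u'. u \<in> dual_monoid M \<sigma> \<Longrightarrow> u' \<in> dual_monoid M \<sigma> \<Longrightarrow> u + u' \<in> dual_monoid M \<sigma>"
    and dual_monoid_scaleR: "\<And>u k. u \<in> dual_monoid M \<sigma> \<Longrightarrow> real k *\<^sub>R u \<in> dual_monoid M \<sigma>"
  using lattice_0[OF assms] lattice_add[OF assms] lattice_scaleR_nat[OF assms]
  by (auto simp: dual_cone_def inner_add_right add_nonpos_nonpos mult_nonneg_nonpos)

text \<open>
  The monoid of the face \<open>\<tau>\<close> arises from the monoid of \<open>\<sigma>\<close> by inverting \<open>m\<close>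
  (\<open>localizes_multiple\<close>).
\<close>

definition localizes :: "'a::euclidean_space set \<Rightarrow> 'a \<Rightarrow> 'a set \<Rightarrow> 'a set \<Rightarrow> bool" where
  "localizes M m \<tau> \<sigma> \<longleftrightarrow> m \<in> dual_monoid M \<sigma> \<and> \<tau> = {x\<in>\<sigma>. x \<bullet> m = 0}"

text \<open>
  Faces of the polyhedron \<open>\<sigma>\<close> are exposed, so a real functional \<open>a\<close> cuts out \<open>\<tau>\<close>. An integral
  functional with the same signs on the generators of \<open>\<sigma>\<close> cuts out the same face.
\<close>

lemma cone_face_localizes:
  fixes M :: "'a::euclidean_space set"
  assumes M: "full_lattice M" and \<sigma>: "rational_cone M \<sigma>" and \<tau>: "cone_face \<tau> \<sigma>"
  obtains m where "localizes M m \<tau> \<sigma>"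
proof -
  obtain S where S: "finite S" "S \<subseteq> dual_lattice M" "\<sigma> = convex_cone hull S"
    using \<sigma> unfolding rational_cone_def by blast
  have "\<tau> exposed_face_of \<sigma>"
    using \<tau> exposed_face_of_polyhedron[OF polyhedron_convex_cone_hull[OF S(1)]]
    unfolding cone_face_def S(3) by blast
  then obtain a b where ab: "\<sigma> \<subseteq> {x. a \<bullet> x \<le> b}" "\<tau> = \<sigma> \<inter> {x. a \<bullet> x = b}"
    unfolding exposed_face_of_def by blast
  have cone: "convex_cone \<sigma>" unfolding S(3) by (rule convex_cone_convex_cone_hull)
  obtain y where y: "y \<in> \<sigma>" "a \<bullet> y = b" using \<tau> ab(2) unfolding cone_face_def by blast
  have "0 \<le> b" using convex_cone_contains_0[OF cone] ab(1) by auto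
  moreover have "2 *\<^sub>R y \<in> \<sigma>" using convex_cone_scaleR[OF cone _ y(1), of 2] by simp
  then have "2 * b \<le> b" using ab(1) y(2) by auto
  ultimately have b: "b = 0" by simp
  obtain m where m: "m \<in> M" "\<And>s. s \<in> S \<Longrightarrow> sgn (s \<bullet> m) = sgn (s \<bullet> a)"
    using integral_functional_same_signs[OF M S(1,2)] by blast
  have "s \<bullet> a \<le> 0" if "s \<in> S" for s
    using ab(1) b hull_inc[of s S convex_cone] that unfolding S(3) by (auto simp: inner_commute)
  then have sm: "s \<bullet> m \<le> 0" if "s \<in> S" for s
    using m(2)[OF that] that by (force simp: sgn_if split: if_splits)
  then have md: "m \<in> dual_cone \<sigma>" unfolding S(3) dual_cone_convex_cone_hull by blast
  have "convex_cone hull S \<subseteq> {x. x \<in> \<sigma> \<and> (x \<bullet> m = 0 \<longleftrightarrow> x \<bullet> a = 0)}"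
  proof (rule hull_minimal)
    show "S \<subseteq> {x. x \<in> \<sigma> \<and> (x \<bullet> m = 0 \<longleftrightarrow> x \<bullet> a = 0)}"
    proof safe
      fix s assume s: "s \<in> S"
      show "s \<in> \<sigma>" unfolding S(3) by (rule hull_inc[OF s])
      show "s \<bullet> a = 0" if "s \<bullet> m = 0" using m(2)[OF s] that by (simp add: sgn_0_0)
      show "s \<bullet> m = 0" if "s \<bullet> a = 0" using m(2)[OF s] that by (simp add: sgn_0_0)
    qed
    have am: "x \<bullet> a \<le> 0 \<and> x \<bullet> m \<le> 0" if "x \<in> \<sigma>" for x
      using that ab(1) md b by (auto simp: inner_commute dual_cone_def)
    show "convex_cone {x. x \<in> \<sigma> \<and> (x \<bullet> m = 0 \<longleftrightarrow> x \<bullet> a = 0)}"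
      unfolding convex_cone_iff
    proof (intro conjI ballI allI impI)
      fix x y assume xy: "x \<in> {x. x \<in> \<sigma> \<and> (x \<bullet> m = 0 \<longleftrightarrow> x \<bullet> a = 0)}"
        "y \<in> {x. x \<in> \<sigma> \<and> (x \<bullet> m = 0 \<longleftrightarrow> x \<bullet> a = 0)}"
      then have "x \<bullet> a \<le> 0" "x \<bullet> m \<le> 0" "y \<bullet> a \<le> 0" "y \<bullet> m \<le> 0" using am by auto
      with xy show "x + y \<in> {x. x \<in> \<sigma> \<and> (x \<bullet> m = 0 \<longleftrightarrow> x \<bullet> a = 0)}"
        using convex_cone_add[OF cone] by (auto simp: inner_add_left add_nonpos_eq_0_iff)
    qed (use convex_cone_contains_0[OF cone] convex_cone_scaleR[OF cone] in auto)
  qed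
  then have "x \<bullet> m = 0 \<longleftrightarrow> x \<bullet> a = 0" if "x \<in> \<sigma>" for x
    using that unfolding S(3) by blast
  then have "localizes M m \<tau> \<sigma>"
    using md m(1) ab(2) b by (auto simp: localizes_def inner_commute)
  then show thesis by (rule that)
qed

text \<open>
  On a generator of \<open>\<sigma>\<close> in \<open>\<tau>\<close> the functional \<open>u\<close> is nonpositive and \<open>m\<close> vanishes; on any other
  generator \<open>m\<close> is negative, and a large multiple of it outweighs \<open>u\<close>.
\<close>

lemma localizes_multiple:
  assumes M: "full_lattice M" and \<sigma>: "rational_cone M \<sigma>" and m: "localizes M m \<tau> \<sigma>"
    and u: "u \<in> dual_monoid M \<tau>"
  shows "\<exists>k. u + real k *\<^sub>R m \<in> dual_monoid M \<sigma>"
proof -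
  obtain S where S: "finite S" "\<sigma> = convex_cone hull S"
    using \<sigma> unfolding rational_cone_def by blast
  have "\<exists>k. s \<bullet> u + real k * (s \<bullet> m) \<le> 0" if "s \<in> S" for s
  proof (cases "s \<bullet> m = 0")
    case True
    then have "s \<in> \<tau>" using m hull_inc[OF that] S(2) by (auto simp: localizes_def)
    then show ?thesis using u True by (auto simp: dual_cone_def)
  next
    case False
    moreover have "s \<bullet> m \<le> 0"
      using m that unfolding localizes_def S(2) dual_cone_convex_cone_hull by blast
    ultimately have "- (s \<bullet> m) > 0" by simp
    from reals_Archimedean3[OF this] obtain k where "s \<bullet> u < real k * - (s \<bullet> m)" by blast
    then show ?thesis by (intro exI[of _ k]) simp
  qed
  then obtain k where k: "\<And>s. s \<in> S \<Longrightarrow> s \<bullet> u + real (k s) * (s \<bullet> m) \<le> 0" by metis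
  have "s \<bullet> (u + real (sum k S) *\<^sub>R m) \<le> 0" if "s \<in> S" for s
  proof -
    have "s \<bullet> m \<le> 0"
      using m that unfolding localizes_def S(2) dual_cone_convex_cone_hull by blast
    moreover have "k s \<le> sum k S" using S(1) that by (simp add: member_le_sum)
    ultimately have "real (sum k S) * (s \<bullet> m) \<le> real (k s) * (s \<bullet> m)"
      by (intro mult_right_mono_neg) (simp_all del: of_nat_sum)
    then show ?thesis using k[OF that] by (simp add: inner_add_right del: of_nat_sum)
  qed
  moreover have "u + real (sum k S) *\<^sub>R m \<in> M"
    using u m lattice_add[OF M] lattice_scaleR_nat[OF M] by (auto simp: localizes_def simp del: of_nat_sum)
  ultimately show ?thesis
    unfolding S(2) dual_cone_convex_cone_hull by blast
qed

section \<open>The chart of a face as an open part of a chart\<close>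

lemma chart_pointD:
  assumes "\<phi> \<in> trop_chart_points M \<sigma>"
  shows chart_point_not_PInf: "\<And>u. u \<in> dual_monoid M \<sigma> \<Longrightarrow> \<phi> u \<noteq> \<infinity>"
    and chart_point_0: "\<phi> 0 = 0"
    and chart_point_add: "\<And>u u'. u \<in> dual_monoid M \<sigma> \<Longrightarrow> u' \<in> dual_monoid M \<sigma> \<Longrightarrow> \<phi> (u + u') = \<phi> u + \<phi> u'"
    and chart_point_extensional: "\<phi> \<in> extensional (dual_monoid M \<sigma>)"
  using assms by (auto simp: trop_chart_points_def PiE_def)

lemma chart_point_add_multiple:
  assumes M: "full_lattice M" and \<phi>: "\<phi> \<in> trop_chart_points M \<sigma>"
    and u: "u \<in> dual_monoid M \<sigma>" and m: "m \<in> dual_monoid M \<sigma>" and c: "\<phi> m = ereal c"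
  shows "\<phi> (u + real k *\<^sub>R m) = \<phi> u + ereal (real k * c)"
proof (induction k)
  case (Suc k)
  have "\<phi> ((u + real k *\<^sub>R m) + m) = \<phi> (u + real k *\<^sub>R m) + \<phi> m"
    by (intro chart_point_add[OF \<phi>] dual_monoid_add[OF M] dual_monoid_scaleR[OF M] u m)
  moreover have "u + real (Suc k) *\<^sub>R m = (u + real k *\<^sub>R m) + m"
    by (simp add: scaleR_add_left)
  ultimately have "\<phi> (u + real (Suc k) *\<^sub>R m) = \<phi> u + ereal (real k * c) + ereal c"
    by (simp only: Suc c)
  then show ?case by (cases "\<phi> u") (simp_all add: algebra_simps)
qed simp

lemma restrict_chart_point:
  assumes "full_lattice M" "\<tau> \<subseteq> \<sigma>" "\<psi> \<in> trop_chart_points M \<tau>"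
  shows "restrict \<psi> (dual_monoid M \<sigma>) \<in> trop_chart_points M \<sigma>"
proof -
  have sub: "dual_monoid M \<sigma> \<subseteq> dual_monoid M \<tau>" using dual_cone_antimono[OF assms(2)] by blast
  note \<psi> = chart_pointD[OF assms(3)]
  show ?thesis
    unfolding trop_chart_points_def
  proof (intro CollectI conjI ballI PiE_I)
    show "restrict \<psi> (dual_monoid M \<sigma>) 0 = 0"
      using dual_monoid_0[OF assms(1), of \<sigma>] \<psi>(2) by (simp only: restrict_apply if_True)
    fix u u' assume u: "u \<in> dual_monoid M \<sigma>" "u' \<in> dual_monoid M \<sigma>"
    then show "restrict \<psi> (dual_monoid M \<sigma>) (u + u') =
        restrict \<psi> (dual_monoid M \<sigma>) u + restrict \<psi> (dual_monoid M \<sigma>) u'"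
      using dual_monoid_add[OF assms(1) u] \<psi>(3)[OF subsetD[OF sub u(1)] subsetD[OF sub u(2)]]
      by (simp only: restrict_apply if_True)
  next
    fix u assume u: "u \<in> dual_monoid M \<sigma>"
    then show "restrict \<psi> (dual_monoid M \<sigma>) u \<in> - {\<infinity>}"
      using \<psi>(1)[OF subsetD[OF sub u]] by auto
  qed auto
qed

lemma localizes_subset: "localizes M m \<tau> \<sigma> \<Longrightarrow> \<tau> \<subseteq> \<sigma>"
  by (auto simp: localizes_def)

lemma localizes_dual:
  assumes "localizes M m \<tau> \<sigma>"
  shows "m \<in> dual_monoid M \<sigma>" "dual_monoid M \<sigma> \<subseteq> dual_monoid M \<tau>"
  using assms dual_cone_antimono[OF localizes_subset[OF assms]] by (auto simp: localizes_def)

lemma localizes_finite: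
  assumes M: "full_lattice M" and m: "localizes M m \<tau> \<sigma>" and \<psi>: "\<psi> \<in> trop_chart_points M \<tau>"
  obtains c where "\<psi> m = ereal c"
proof -
  have mD: "m \<in> dual_monoid M \<tau>" "- m \<in> dual_monoid M \<tau>"
    using m lattice_minus[OF M] by (auto simp: localizes_def dual_cone_def)
  have "\<psi> m + \<psi> (- m) = 0"
    using chart_point_add[OF \<psi> mD] chart_point_0[OF \<psi>] by simp
  then show thesis
    using that by (cases "\<psi> m"; cases "\<psi> (- m)") auto
qed

text \<open>
  The extension of \<open>\<phi>\<close> from the monoid of \<open>\<sigma>\<close> to that of \<open>\<tau>\<close>, forced by
  \<open>\<phi> (u + k m) = \<phi> u + k \<phi> m\<close>; it is meaningful when \<open>\<phi> m\<close> is finite. The subtraction is written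
  as addition of a finite number, since \<open>\<infinity>\<close> is not a value of a chart point.
\<close>

definition extend :: "'a::euclidean_space set \<Rightarrow> 'a \<Rightarrow> 'a set \<Rightarrow> 'a set \<Rightarrow> ('a \<Rightarrow> ereal) \<Rightarrow> 'a \<Rightarrow> ereal" where
  "extend M m \<tau> \<sigma> \<phi> = (\<lambda>u\<in>dual_monoid M \<tau>.
     let k = (SOME k. u + real k *\<^sub>R m \<in> dual_monoid M \<sigma>)
     in \<phi> (u + real k *\<^sub>R m) + ereal (- (real k * real_of_ereal (\<phi> m))))"

text \<open>
  The chart of the face \<open>\<tau>\<close> is identified with the part \<open>\<phi> m \<noteq> -\<infinity>\<close> of the chart of \<open>\<sigma>\<close>: \<open>extend\<close> and
  restriction are inverse to each other and continuous.
\<close>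

locale localization =
  fixes M :: "'a::euclidean_space set" and m \<tau> \<sigma>
  assumes M: "full_lattice M" and \<sigma>: "rational_cone M \<sigma>" and m: "localizes M m \<tau> \<sigma>"
begin

text \<open>
  The exponent \<open>k\<close> is immaterial: two choices are compared at \<open>u + (j + k) m\<close>.
\<close>

lemma extend_eq:
  assumes \<phi>: "\<phi> \<in> trop_chart_points M \<sigma>" and c: "\<phi> m = ereal c"
    and u: "u \<in> dual_monoid M \<tau>" and k: "u + real k *\<^sub>R m \<in> dual_monoid M \<sigma>"
  shows "extend M m \<tau> \<sigma> \<phi> u = \<phi> (u + real k *\<^sub>R m) + ereal (- (real k * c))"
proof -
  define j where "j = (SOME k. u + real k *\<^sub>R m \<in> dual_monoid M \<sigma>)"
  have j: "u + real j *\<^sub>R m \<in> dual_monoid M \<sigma>"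
    unfolding j_def by (rule someI[of _ k]) (rule k)
  have "\<phi> (u + real j *\<^sub>R m + real k *\<^sub>R m) = \<phi> (u + real k *\<^sub>R m + real j *\<^sub>R m)"
    by (simp add: algebra_simps)
  then have "\<phi> (u + real j *\<^sub>R m) + ereal (real k * c) = \<phi> (u + real k *\<^sub>R m) + ereal (real j * c)"
    unfolding chart_point_add_multiple[OF M \<phi> j localizes_dual(1)[OF m] c]
      chart_point_add_multiple[OF M \<phi> k localizes_dual(1)[OF m] c] .
  then have "\<phi> (u + real j *\<^sub>R m) + ereal (- (real j * c)) = \<phi> (u + real k *\<^sub>R m) + ereal (- (real k * c))"
    by (cases "\<phi> (u + real j *\<^sub>R m)"; cases "\<phi> (u + real k *\<^sub>R m)") auto
  moreover have "extend M m \<tau> \<sigma> \<phi> u = \<phi> (u + real j *\<^sub>R m) + ereal (- (real j * real_of_ereal (\<phi> m)))"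
    unfolding extend_def restrict_apply'[OF u] Let_def j_def ..
  ultimately show ?thesis
    using c by simp
qed

lemma extend_chart_point:
  assumes \<phi>: "\<phi> \<in> trop_chart_points M \<sigma>" and c: "\<phi> m = ereal c"
  shows "extend M m \<tau> \<sigma> \<phi> \<in> trop_chart_points M \<tau>"
    and "restrict (extend M m \<tau> \<sigma> \<phi>) (dual_monoid M \<sigma>) = \<phi>"
proof -
  let ?e = "extend M m \<tau> \<sigma> \<phi>"
  have on_\<sigma>: "?e u = \<phi> u" if "u \<in> dual_monoid M \<sigma>" for u
    using extend_eq[OF \<phi> c subsetD[OF localizes_dual(2)[OF m] that], of 0] that
    by (simp flip: zero_ereal_def)
  show "restrict ?e (dual_monoid M \<sigma>) = \<phi>"
    by (rule extensionalityI[OF restrict_extensional chart_point_extensional[OF \<phi>]])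
      (simp only: restrict_apply if_True on_\<sigma>)
  show "?e \<in> trop_chart_points M \<tau>"
    unfolding trop_chart_points_def
  proof (intro CollectI conjI ballI PiE_I)
    show "?e 0 = 0"
      using on_\<sigma>[OF dual_monoid_0[OF M]] chart_point_0[OF \<phi>] by simp
  next
    fix u u' assume u: "u \<in> dual_monoid M \<tau>" "u' \<in> dual_monoid M \<tau>"
    obtain k where k: "u + real k *\<^sub>R m \<in> dual_monoid M \<sigma>"
      using localizes_multiple[OF M \<sigma> m u(1)] by blast
    obtain k' where k': "u' + real k' *\<^sub>R m \<in> dual_monoid M \<sigma>"
      using localizes_multiple[OF M \<sigma> m u(2)] by blast
    have sum: "(u + u') + real (k + k') *\<^sub>R m = (u + real k *\<^sub>R m) + (u' + real k' *\<^sub>R m)"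
      by (simp add: algebra_simps)
    have "(u + u') + real (k + k') *\<^sub>R m \<in> dual_monoid M \<sigma>"
      unfolding sum by (rule dual_monoid_add[OF M k k'])
    from extend_eq[OF \<phi> c dual_monoid_add[OF M u] this]
    have "?e (u + u') = \<phi> (u + real k *\<^sub>R m) + \<phi> (u' + real k' *\<^sub>R m) + ereal (- (real (k + k') * c))"
      unfolding sum chart_point_add[OF \<phi> k k'] .
    then show "?e (u + u') = ?e u + ?e u'"
      unfolding extend_eq[OF \<phi> c u(1) k] extend_eq[OF \<phi> c u(2) k']
      by (cases "\<phi> (u + real k *\<^sub>R m)"; cases "\<phi> (u' + real k' *\<^sub>R m)") (auto simp: algebra_simps)
  next
    fix u assume u: "u \<in> dual_monoid M \<tau>"
    obtain k where k: "u + real k *\<^sub>R m \<in> dual_monoid M \<sigma>"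
      using localizes_multiple[OF M \<sigma> m u] by blast
    show "?e u \<in> - {\<infinity>}"
      using chart_point_not_PInf[OF \<phi> k] unfolding extend_eq[OF \<phi> c u k] by auto
  qed (simp only: extend_def restrict_apply if_False)
qed

lemma extend_restrict:
  assumes \<psi>: "\<psi> \<in> trop_chart_points M \<tau>"
  shows "extend M m \<tau> \<sigma> (restrict \<psi> (dual_monoid M \<sigma>)) = \<psi>"
proof (rule extensionalityI[OF _ chart_point_extensional[OF \<psi>]])
  let ?\<phi> = "restrict \<psi> (dual_monoid M \<sigma>)"
  show "extend M m \<tau> \<sigma> ?\<phi> \<in> extensional (dual_monoid M \<tau>)"
    unfolding extend_def by (rule restrict_extensional)
  fix u assume u: "u \<in> dual_monoid M \<tau>"
  note m\<sigma> = localizes_dual[OF m]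
  obtain c where c: "\<psi> m = ereal c" using localizes_finite[OF M m \<psi>] .
  obtain k where k: "u + real k *\<^sub>R m \<in> dual_monoid M \<sigma>"
    using localizes_multiple[OF M \<sigma> m u] by blast
  have "?\<phi> m = ereal c" using m\<sigma>(1) c by (simp only: restrict_apply if_True)
  from extend_eq[OF restrict_chart_point[OF M localizes_subset[OF m] \<psi>] this u k]
  have "extend M m \<tau> \<sigma> ?\<phi> u = \<psi> (u + real k *\<^sub>R m) + ereal (- (real k * c))"
    unfolding restrict_apply'[OF k] .
  also have "\<dots> = \<psi> u"
    unfolding chart_point_add_multiple[OF M \<psi> u subsetD[OF m\<sigma>(2) m\<sigma>(1)] c]
    by (cases "\<psi> u") auto
  finally show "extend M m \<tau> \<sigma> ?\<phi> u = \<psi> u" .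
qed

end

lemma continuous_map_chart_coordinate:
  assumes "u \<in> dual_monoid M \<sigma>"
  shows "continuous_map (trop_chart M \<sigma>) euclidean (\<lambda>\<phi>. \<phi> u)"
  using continuous_map_product_projection[OF assms, of "\<lambda>_. trop_numbers"]
  unfolding trop_chart_def trop_numbers_def
  by (intro continuous_map_from_subtopology) (auto simp: continuous_map_in_subtopology)

lemma continuous_map_into_chart:
  assumes "\<And>x. x \<in> topspace X \<Longrightarrow> f x \<in> trop_chart_points M \<sigma>"
    and "\<And>u. u \<in> dual_monoid M \<sigma> \<Longrightarrow> continuous_map X euclidean (\<lambda>x. f x u)"
  shows "continuous_map X (trop_chart M \<sigma>) f"
  unfolding trop_chart_def continuous_map_in_subtopology continuous_map_componentwise trop_numbers_def
  using assms chart_pointD[of _ M \<sigma>] by (fastforce simp: image_subset_iff)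

lemma continuous_map_restrict_chart:
  assumes M: "full_lattice M" and "\<tau> \<subseteq> \<sigma>"
  shows "continuous_map (trop_chart M \<tau>) (trop_chart M \<sigma>) (\<lambda>\<psi>. restrict \<psi> (dual_monoid M \<sigma>))"
proof (rule continuous_map_into_chart)
  fix u assume u: "u \<in> dual_monoid M \<sigma>"
  then have "u \<in> dual_monoid M \<tau>" using dual_cone_antimono[OF assms(2)] by blast
  from continuous_map_chart_coordinate[OF this] u
  show "continuous_map (trop_chart M \<tau>) euclidean (\<lambda>\<psi>. restrict \<psi> (dual_monoid M \<sigma>) u)"
    by (simp only: restrict_apply if_True)
qed (use restrict_chart_point[OF assms] topspace_trop_chart in blast)

context localization
begin

lemma openin_finite_locus: "openin (trop_chart M \<sigma>) {\<phi> \<in> trop_chart_points M \<sigma>. \<phi> m \<noteq> - \<infinity>}"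
proof -
  have "openin (trop_chart M \<sigma>) {\<phi> \<in> topspace (trop_chart M \<sigma>). \<phi> m \<in> - {- \<infinity>}}"
    using continuous_map_chart_coordinate[OF localizes_dual(1)[OF m]]
    by (rule openin_continuous_map_preimage) auto
  then show ?thesis by (simp add: topspace_trop_chart)
qed

lemma finite_locusE:
  assumes "\<phi> \<in> trop_chart_points M \<sigma>" "\<phi> m \<noteq> - \<infinity>"
  obtains c where "\<phi> m = ereal c"
  using assms(2) chart_point_not_PInf[OF assms(1) localizes_dual(1)[OF m]] that by (cases "\<phi> m") auto

lemma continuous_map_extend:
  "continuous_map (subtopology (trop_chart M \<sigma>) {\<phi> \<in> trop_chart_points M \<sigma>. \<phi> m \<noteq> - \<infinity>})
     (trop_chart M \<tau>) (extend M m \<tau> \<sigma>)"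
  (is "continuous_map ?X _ _")
proof (rule continuous_map_into_chart)
  have X: "\<phi> \<in> trop_chart_points M \<sigma>" "\<phi> m \<noteq> - \<infinity>" if "\<phi> \<in> topspace ?X" for \<phi>
    using that by (auto simp: topspace_trop_chart)
  show "extend M m \<tau> \<sigma> \<phi> \<in> trop_chart_points M \<tau>" if "\<phi> \<in> topspace ?X" for \<phi>
    using finite_locusE[OF X[OF that]] extend_chart_point(1)[OF X(1)[OF that]] by blast
  fix u assume u: "u \<in> dual_monoid M \<tau>"
  obtain k where k: "u + real k *\<^sub>R m \<in> dual_monoid M \<sigma>"
    using localizes_multiple[OF M \<sigma> m u] by blast
  have "continuous_map ?X euclidean (\<lambda>\<phi>. \<phi> (u + real k *\<^sub>R m) + ereal (- (real k * real_of_ereal (\<phi> m))))"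
    unfolding continuous_map_atin limitin_canonical_iff
  proof
    fix \<phi> assume \<phi>: "\<phi> \<in> topspace ?X"
    obtain c where c: "\<phi> m = ereal c" using finite_locusE[OF X[OF \<phi>]] .
    have coord: "((\<lambda>\<phi>. \<phi> v) \<longlongrightarrow> \<phi> v) (atin ?X \<phi>)" if "v \<in> dual_monoid M \<sigma>" for v
      using continuous_map_from_subtopology[OF continuous_map_chart_coordinate[OF that]] \<phi>
      unfolding continuous_map_atin limitin_canonical_iff by blast
    have "((\<lambda>\<phi>. real_of_ereal (\<phi> m)) \<longlongrightarrow> c) (atin ?X \<phi>)"
      using coord[OF localizes_dual(1)[OF m]] unfolding c by (rule lim_real_of_ereal)
    then show "((\<lambda>\<phi>. \<phi> (u + real k *\<^sub>R m) + ereal (- (real k * real_of_ereal (\<phi> m))))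
        \<longlongrightarrow> \<phi> (u + real k *\<^sub>R m) + ereal (- (real k * real_of_ereal (\<phi> m)))) (atin ?X \<phi>)"
      by (intro tendsto_add_ereal_general1 coord[OF k]) (auto simp: c intro!: tendsto_intros)
  qed
  then show "continuous_map ?X euclidean (\<lambda>\<phi>. extend M m \<tau> \<sigma> \<phi> u)"
  proof (rule continuous_map_eq)
    fix \<phi> assume \<phi>: "\<phi> \<in> topspace ?X"
    obtain c where c: "\<phi> m = ereal c" using finite_locusE[OF X[OF \<phi>]] .
    from extend_eq[OF X(1)[OF \<phi>] c u k] c
    show "\<phi> (u + real k *\<^sub>R m) + ereal (- (real k * real_of_ereal (\<phi> m))) = extend M m \<tau> \<sigma> \<phi> u"
      by simp
  qed
qed

text \<open>
  The points of the chart of \<open>\<sigma>\<close> that come from the chart of the face \<open>\<tau>\<close> form an open set, on which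
  the passage to the chart of another cone \<open>\<rho>\<close> containing \<open>\<tau>\<close> is continuous.
\<close>

lemma openin_chart_overlap:
  assumes "\<tau> \<subseteq> \<rho>" and U: "openin (trop_chart M \<rho>) U"
  shows "openin (trop_chart M \<sigma>) {\<phi>. \<exists>\<theta>\<in>trop_chart_points M \<tau>.
           restrict \<theta> (dual_monoid M \<sigma>) = \<phi> \<and> restrict \<theta> (dual_monoid M \<rho>) \<in> U}"
    (is "openin _ ?V")
proof -
  let ?O = "{\<phi> \<in> trop_chart_points M \<sigma>. \<phi> m \<noteq> - \<infinity>}"
  let ?X = "subtopology (trop_chart M \<sigma>) ?O"
  have top: "topspace ?X = ?O" by (auto simp: topspace_trop_chart)
  have "continuous_map ?X (trop_chart M \<rho>) ((\<lambda>\<psi>. restrict \<psi> (dual_monoid M \<rho>)) \<circ> extend M m \<tau> \<sigma>)"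
    by (rule continuous_map_compose[OF continuous_map_extend continuous_map_restrict_chart[OF M assms(1)]])
  from openin_continuous_map_preimage[OF this U]
  have "openin (trop_chart M \<sigma>) {\<phi> \<in> ?O. restrict (extend M m \<tau> \<sigma> \<phi>) (dual_monoid M \<rho>) \<in> U}"
    unfolding top o_def by (rule openin_trans_full[OF _ openin_finite_locus])
  also have "{\<phi> \<in> ?O. restrict (extend M m \<tau> \<sigma> \<phi>) (dual_monoid M \<rho>) \<in> U} = ?V"
  proof (intro equalityI subsetI)
    fix \<phi> assume "\<phi> \<in> {\<phi> \<in> ?O. restrict (extend M m \<tau> \<sigma> \<phi>) (dual_monoid M \<rho>) \<in> U}"
    then have \<phi>: "\<phi> \<in> trop_chart_points M \<sigma>" "\<phi> m \<noteq> - \<infinity>"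
      and \<phi>U: "restrict (extend M m \<tau> \<sigma> \<phi>) (dual_monoid M \<rho>) \<in> U" by blast+
    obtain c where "\<phi> m = ereal c" using finite_locusE[OF \<phi>] .
    from extend_chart_point[OF \<phi>(1) this] \<phi>U show "\<phi> \<in> ?V" by blast
  next
    fix \<phi> assume "\<phi> \<in> ?V"
    then obtain \<theta> where \<theta>: "\<theta> \<in> trop_chart_points M \<tau>" "restrict \<theta> (dual_monoid M \<sigma>) = \<phi>"
      "restrict \<theta> (dual_monoid M \<rho>) \<in> U" by blast
    obtain c where "\<theta> m = ereal c" using localizes_finite[OF M m \<theta>(1)] .
    then have "\<phi> m \<noteq> - \<infinity>" using \<theta>(2) localizes_dual(1)[OF m] by (auto simp: restrict_apply)
    then show "\<phi> \<in> {\<phi> \<in> ?O. restrict (extend M m \<tau> \<sigma> \<phi>) (dual_monoid M \<rho>) \<in> U}"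
      using restrict_chart_point[OF M localizes_subset[OF m] \<theta>(1)] extend_restrict[OF \<theta>(1)] \<theta>(2,3)
      by simp
  qed
  finally show ?thesis .
qed

end

text \<open>
  All representatives, in the charts of the fan, of the points of the part \<open>U\<close> of the chart of \<open>\<sigma>\<close>.
  Passing directly through the chart of the single cone \<open>\<sigma> \<inter> \<rho>\<close> avoids an analysis of the
  chains of identifications that generate the gluing relation.
\<close>

definition chart_image :: "'a::euclidean_space set \<Rightarrow> 'a set set \<Rightarrow> 'a set \<Rightarrow> ('a \<Rightarrow> ereal) set \<Rightarrow> ('a set \<times> ('a \<Rightarrow> ereal)) set" where
  "chart_image M \<Sigma> \<sigma> U = {(\<rho>, \<psi>). \<rho> \<in> \<Sigma> \<and> (\<exists>\<theta>\<in>trop_chart_points M (\<sigma> \<inter> \<rho>).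
     restrict \<theta> (dual_monoid M \<rho>) = \<psi> \<and> restrict \<theta> (dual_monoid M \<sigma>) \<in> U)}"

lemma chart_imageI:
  assumes "\<rho> \<in> \<Sigma>" "\<theta> \<in> trop_chart_points M (\<sigma> \<inter> \<rho>)"
    and "restrict \<theta> (dual_monoid M \<sigma>) \<in> U"
  shows "(\<rho>, restrict \<theta> (dual_monoid M \<rho>)) \<in> chart_image M \<Sigma> \<sigma> U"
  using assms by (auto simp: chart_image_def)

lemma chart_imageE:
  assumes "(\<rho>, \<psi>) \<in> chart_image M \<Sigma> \<sigma> U"
  obtains \<theta> where "\<theta> \<in> trop_chart_points M (\<sigma> \<inter> \<rho>)"
    "restrict \<theta> (dual_monoid M \<rho>) = \<psi>" "restrict \<theta> (dual_monoid M \<sigma>) \<in> U"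
proof -
  have "\<exists>\<theta>\<in>trop_chart_points M (\<sigma> \<inter> \<rho>).
      restrict \<theta> (dual_monoid M \<rho>) = \<psi> \<and> restrict \<theta> (dual_monoid M \<sigma>) \<in> U"
    using assms unfolding chart_image_def mem_Collect_eq prod.case by (rule conjunct2)
  then show thesis using that by (elim bexE conjE)
qed

lemma fanD:
  assumes "fan M \<Sigma>" "\<sigma> \<in> \<Sigma>" "\<rho> \<in> \<Sigma>"
  shows "rational_cone M \<sigma>" "cone_face (\<sigma> \<inter> \<rho>) \<rho>" "cone_face \<tau> \<sigma> \<Longrightarrow> \<tau> \<in> \<Sigma>" "strongly_convex \<sigma>"
  using assms unfolding fan_def by blast+

lemma openin_chart_image:
  fixes M :: "'a::euclidean_space set"
  assumes M: "full_lattice M" and \<Sigma>: "fan M \<Sigma>" "\<sigma> \<in> \<Sigma>" and U: "openin (trop_chart M \<sigma>) U"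
  shows "openin (sum_topology (trop_chart M) \<Sigma>) (chart_image M \<Sigma> \<sigma> U)"
  unfolding openin_sum_topology
proof (intro conjI ballI)
  show "chart_image M \<Sigma> \<sigma> U \<subseteq> Sigma \<Sigma> (topspace \<circ> trop_chart M)"
    using restrict_chart_point[OF M Int_lower2] by (auto simp: chart_image_def topspace_trop_chart)
  fix \<rho> assume \<rho>: "\<rho> \<in> \<Sigma>"
  obtain m where m: "localizes M m (\<sigma> \<inter> \<rho>) \<rho>"
    using cone_face_localizes[OF M fanD(1)[OF \<Sigma>(1) \<rho> \<rho>] fanD(2)[OF \<Sigma> \<rho>]] .
  then interpret localization M m "\<sigma> \<inter> \<rho>" \<rho>
    by unfold_locales (use M fanD(1)[OF \<Sigma>(1) \<rho> \<rho>] in auto)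
  have "{\<psi>. (\<rho>, \<psi>) \<in> chart_image M \<Sigma> \<sigma> U} = {\<psi>. \<exists>\<theta>\<in>trop_chart_points M (\<sigma> \<inter> \<rho>).
     restrict \<theta> (dual_monoid M \<rho>) = \<psi> \<and> restrict \<theta> (dual_monoid M \<sigma>) \<in> U}"
    using \<rho> by (auto simp: chart_image_def)
  then show "openin (trop_chart M \<rho>) {\<psi>. (\<rho>, \<psi>) \<in> chart_image M \<Sigma> \<sigma> U}"
    using openin_chart_overlap[OF Int_lower1 U] by simp
qed

lemma restrict_restrict_dual:
  assumes "\<tau> \<subseteq> \<sigma>"
  shows "restrict (restrict \<psi> (dual_monoid M \<tau>)) (dual_monoid M \<sigma>) = restrict \<psi> (dual_monoid M \<sigma>)"
  using dual_cone_antimono[OF assms] by (auto simp: restrict_def fun_eq_iff)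

text \<open>
  Let \<open>\<tau>\<close> be a face of \<open>\<rho>\<close>. A witness on \<open>\<sigma> \<inter> \<tau>\<close> restricts to one on \<open>\<sigma> \<inter> \<rho>\<close>. Conversely, let
  \<open>\<theta>\<close> be a witness on \<open>\<sigma> \<inter> \<rho>\<close> for the restriction of \<open>\<psi>\<close> to \<open>\<rho>\<close>. The functional \<open>m\<close> that cuts
  \<open>\<sigma> \<inter> \<rho>\<close> out of \<open>\<rho>\<close> cuts \<open>\<sigma> \<inter> \<tau>\<close> out of \<open>\<tau>\<close>, and \<open>\<psi> m = \<theta> m\<close> is finite, so \<open>\<psi>\<close> extends to
  \<open>\<sigma> \<inter> \<tau>\<close>. The extension agrees with \<open>\<theta>\<close> on the monoid of \<open>\<sigma>\<close>, because both are determined by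
  the common values on the monoid of \<open>\<rho>\<close>.
\<close>

lemma chart_image_glue:
  fixes M :: "'a::euclidean_space set"
  assumes M: "full_lattice M" and \<Sigma>: "fan M \<Sigma>" "\<sigma> \<in> \<Sigma>" and glue: "trop_glue M \<Sigma> p q"
  shows "p \<in> chart_image M \<Sigma> \<sigma> U \<longleftrightarrow> q \<in> chart_image M \<Sigma> \<sigma> U"
proof -
  obtain \<tau> \<rho> \<psi> where \<tau>: "\<tau> \<in> \<Sigma>" and \<rho>: "\<rho> \<in> \<Sigma>" and face: "cone_face \<tau> \<rho>"
    and \<psi>: "\<psi> \<in> trop_chart_points M \<tau>"
    and p: "p = (\<tau>, \<psi>)" and q: "q = (\<rho>, restrict \<psi> (dual_monoid M \<rho>))"
    using glue unfolding trop_glue_def by blast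
  have sub: "\<tau> \<subseteq> \<rho>" using face face_of_imp_subset unfolding cone_face_def by blast
  then have sub': "\<sigma> \<inter> \<tau> \<subseteq> \<sigma> \<inter> \<rho>" by blast
  show ?thesis
  proof
    assume "p \<in> chart_image M \<Sigma> \<sigma> U"
    then obtain \<theta> where \<theta>: "\<theta> \<in> trop_chart_points M (\<sigma> \<inter> \<tau>)"
      "restrict \<theta> (dual_monoid M \<tau>) = \<psi>" "restrict \<theta> (dual_monoid M \<sigma>) \<in> U"
      unfolding p by (rule chart_imageE)
    let ?\<theta> = "restrict \<theta> (dual_monoid M (\<sigma> \<inter> \<rho>))"
    have "?\<theta> \<in> trop_chart_points M (\<sigma> \<inter> \<rho>)" by (rule restrict_chart_point[OF M sub' \<theta>(1)])
    moreover have "restrict ?\<theta> (dual_monoid M \<sigma>) \<in> U"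
      unfolding restrict_restrict_dual[OF Int_lower1] by (rule \<theta>(3))
    ultimately have "(\<rho>, restrict ?\<theta> (dual_monoid M \<rho>)) \<in> chart_image M \<Sigma> \<sigma> U"
      by (rule chart_imageI[OF \<rho>])
    moreover have "restrict ?\<theta> (dual_monoid M \<rho>) = restrict (restrict \<theta> (dual_monoid M \<tau>)) (dual_monoid M \<rho>)"
      unfolding restrict_restrict_dual[OF Int_lower2] restrict_restrict_dual[OF sub] ..
    ultimately show "q \<in> chart_image M \<Sigma> \<sigma> U"
      unfolding q \<theta>(2) by (simp only:)
  next
    assume "q \<in> chart_image M \<Sigma> \<sigma> U"
    then obtain \<theta> where \<theta>: "\<theta> \<in> trop_chart_points M (\<sigma> \<inter> \<rho>)"
      "restrict \<theta> (dual_monoid M \<rho>) = restrict \<psi> (dual_monoid M \<rho>)" "restrict \<theta> (dual_monoid M \<sigma>) \<in> U"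
      unfolding q by (rule chart_imageE)
    have agree: "\<theta> u = \<psi> u" if "u \<in> dual_monoid M \<rho>" for u
      using fun_cong[OF \<theta>(2), of u] that by (simp only: restrict_apply if_True)
    obtain m where loc: "localizes M m (\<sigma> \<inter> \<rho>) \<rho>"
      using cone_face_localizes[OF M fanD(1)[OF \<Sigma>(1) \<rho> \<rho>] fanD(2)[OF \<Sigma> \<rho>]] .
    note m\<rho> = localizes_dual[OF loc]
    have m': "localizes M m (\<sigma> \<inter> \<tau>) \<tau>"
      using loc sub dual_cone_antimono[OF sub] unfolding localizes_def by blast
    interpret localization M m "\<sigma> \<inter> \<tau>" \<tau>
      by unfold_locales (use M m' fanD(1)[OF \<Sigma>(1) \<tau> \<tau>] in auto)
    obtain c where c: "\<theta> m = ereal c" using localizes_finite[OF M loc \<theta>(1)] .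
    then have c': "\<psi> m = ereal c" using agree[OF m\<rho>(1)] by simp
    let ?e = "extend M m (\<sigma> \<inter> \<tau>) \<tau> \<psi>"
    note e = extend_chart_point[OF \<psi> c']
    have "restrict ?e (dual_monoid M \<sigma>) = restrict \<theta> (dual_monoid M \<sigma>)"
    proof (rule restrict_ext)
      fix u assume u: "u \<in> dual_monoid M \<sigma>"
      have u\<tau>: "u \<in> dual_monoid M (\<sigma> \<inter> \<tau>)" and u\<rho>: "u \<in> dual_monoid M (\<sigma> \<inter> \<rho>)"
        using u dual_cone_antimono[OF Int_lower1] by blast+
      obtain k where k: "u + real k *\<^sub>R m \<in> dual_monoid M \<rho>"
        using localizes_multiple[OF M fanD(1)[OF \<Sigma>(1) \<rho> \<rho>] loc u\<rho>] by blast
      then have "u + real k *\<^sub>R m \<in> dual_monoid M \<tau>" using dual_cone_antimono[OF sub] by blast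
      from extend_eq[OF \<psi> c' u\<tau> this]
      have "?e u = \<theta> (u + real k *\<^sub>R m) + ereal (- (real k * c))" using agree[OF k] by simp
      also have "\<dots> = \<theta> u"
        unfolding chart_point_add_multiple[OF M \<theta>(1) u\<rho> subsetD[OF m\<rho>(2) m\<rho>(1)] c]
        by (cases "\<theta> u") auto
      finally show "?e u = \<theta> u" .
    qed
    then have "restrict ?e (dual_monoid M \<sigma>) \<in> U" using \<theta>(3) by (simp only:)
    from chart_imageI[OF \<tau> e(1) this] show "p \<in> chart_image M \<Sigma> \<sigma> U"
      unfolding p e(2) .
  qed
qed

section \<open>Limits and closures in the toric variety\<close>

lemma dual_cone_zero: "dual_cone {0} = UNIV"
  by (auto simp: dual_cone_def)

lemma linear_chart_point:
  assumes "full_lattice M"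
  shows "restrict (\<lambda>u. ereal (x \<bullet> u)) (dual_monoid M \<sigma>) \<in> trop_chart_points M \<sigma>"
  using dual_monoid_0[OF assms, of \<sigma>] dual_monoid_add[OF assms, of _ \<sigma>]
  by (auto simp: trop_chart_points_def inner_add_right)

lemma trop_class_eqI:
  assumes "trop_glue M \<Sigma> p q"
  shows "trop_class M \<Sigma> p = trop_class M \<Sigma> q"
  using assms unfolding trop_class_def
  by (blast intro: equivclp_trans r_into_equivclp converse_r_into_equivclp)

lemma trop_glueI:
  assumes "\<tau> \<in> \<Sigma>" "\<sigma> \<in> \<Sigma>" "cone_face \<tau> \<sigma>" "\<psi> \<in> trop_chart_points M \<tau>"
  shows "trop_glue M \<Sigma> (\<tau>, \<psi>) (\<sigma>, restrict \<psi> (dual_monoid M \<sigma>))"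
  unfolding trop_glue_def using assms by (intro bexI[of _ \<tau>] bexI[of _ \<sigma>] bexI[of _ \<psi>] conjI refl)

lemma zero_cone_face:
  assumes \<sigma>: "rational_cone M \<sigma>" "strongly_convex \<sigma>"
  shows "cone_face {0} \<sigma>"
proof -
  have cone: "convex_cone \<sigma>"
    using \<sigma>(1) convex_cone_convex_cone_hull unfolding rational_cone_def by blast
  have pointed: "x = 0 \<and> y = 0" if xy: "x \<in> \<sigma>" "y \<in> \<sigma>" "x + y = 0" for x y
  proof -
    have "x = - y" using xy(3) by (rule eq_neg_iff_add_eq_0[THEN iffD2])
    then have "x \<in> \<sigma> \<inter> uminus ` \<sigma>" using xy by blast
    then have "x = 0" using \<sigma>(2) unfolding strongly_convex_def by simp
    with xy(3) show ?thesis by simp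
  qed
  have "a = 0 \<and> b = 0" if ab: "a \<in> \<sigma>" "b \<in> \<sigma>" "0 \<in> open_segment a b" for a b
  proof -
    obtain u where u: "0 < u" "u < 1" "0 = (1 - u) *\<^sub>R a + u *\<^sub>R b"
      using ab(3) by (auto simp: in_segment)
    have "(1 - u) *\<^sub>R a \<in> \<sigma>" "u *\<^sub>R b \<in> \<sigma>"
      using u(1,2) ab by (auto intro: convex_cone_scaleR[OF cone])
    from pointed[OF this u(3)[symmetric]] show ?thesis using u(1,2) by simp
  qed
  then show ?thesis
    using convex_cone_contains_0[OF cone] by (auto simp: cone_face_def face_of_def)
qed

lemma trop_embed_chart:
  fixes M :: "'a::euclidean_space set"
  assumes M: "full_lattice M" and \<Sigma>: "fan M \<Sigma>" "\<sigma> \<in> \<Sigma>"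
  shows "trop_embed M \<Sigma> x = trop_class M \<Sigma> (\<sigma>, restrict (\<lambda>u. ereal (x \<bullet> u)) (dual_monoid M \<sigma>))"
proof -
  let ?x = "restrict (\<lambda>u. ereal (x \<bullet> u)) (dual_monoid M {0})"
  have face: "cone_face {0} \<sigma>" by (rule zero_cone_face[OF fanD(1)[OF \<Sigma> \<Sigma>(2)] fanD(4)[OF \<Sigma> \<Sigma>(2)]])
  then have "{0} \<subseteq> \<sigma>" using face_of_imp_subset unfolding cone_face_def by blast
  note restrict = restrict_restrict_dual[OF this, of "\<lambda>u. ereal (x \<bullet> u)" M]
  have "trop_glue M \<Sigma> ({0}, ?x) (\<sigma>, restrict ?x (dual_monoid M \<sigma>))"
    by (rule trop_glueI[OF fanD(3)[OF \<Sigma> \<Sigma>(2) face] \<Sigma>(2) face linear_chart_point[OF M]])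
  note glued = trop_class_eqI[OF this, unfolded restrict]
  have "dual_monoid M {0} = M" by (simp add: dual_cone_zero)
  with glued show ?thesis unfolding trop_embed_def by (simp only:)
qed

lemma chart_image_class:
  fixes M :: "'a::euclidean_space set"
  assumes M: "full_lattice M" and \<Sigma>: "fan M \<Sigma>" "\<sigma> \<in> \<Sigma>"
    and p: "p \<in> chart_image M \<Sigma> \<sigma> U" and eq: "trop_class M \<Sigma> q = trop_class M \<Sigma> p"
  shows "q \<in> chart_image M \<Sigma> \<sigma> U"
proof -
  have "q \<in> trop_class M \<Sigma> q" by (simp add: trop_class_def)
  then have "equivclp (trop_glue M \<Sigma>) p q" unfolding eq by (simp add: trop_class_def)
  then show ?thesis
    by (induction rule: equivclp_induct) (use p chart_image_glue[OF M \<Sigma>] in blast)+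
qed

lemma closure_meets_open:
  assumes "x \<in> X closure_of S" "openin X T" "x \<in> T"
  shows "\<exists>y. y \<in> S \<and> y \<in> T"
  using assms by (simp add: in_closure_of)

text \<open>
  Since \<open>chart_image\<close> is open and a union of classes, its image in the quotient is open. It meets the
  image of \<open>L\<close>, and a point \<open>x\<close> of \<open>L\<close> in it has its representative in the chart of \<open>\<sigma>\<close> in \<open>U\<close>.
\<close>

lemma chart_closure:
  fixes M :: "'a::euclidean_space set"
  assumes M: "full_lattice M" and \<Sigma>: "fan M \<Sigma>" "\<sigma> \<in> \<Sigma>"
    and \<phi>: "\<phi> \<in> trop_chart_points M \<sigma>"
    and closure: "trop_class M \<Sigma> (\<sigma>, \<phi>) \<in> trop_toric M \<Sigma> closure_of (trop_embed M \<Sigma> ` L)"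
  shows "\<phi> \<in> trop_chart M \<sigma> closure_of ((\<lambda>x. restrict (\<lambda>u. ereal (x \<bullet> u)) (dual_monoid M \<sigma>)) ` L)"
  unfolding in_closure_of topspace_trop_chart
proof (intro conjI allI impI \<phi>)
  fix U assume U: "\<phi> \<in> U \<and> openin (trop_chart M \<sigma>) U"
  let ?N = "chart_image M \<Sigma> \<sigma> U"
  let ?X = "sum_topology (trop_chart M) \<Sigma>"
  have openN: "openin ?X ?N" using openin_chart_image[OF M \<Sigma>] U by blast
  have "{p \<in> topspace ?X. trop_class M \<Sigma> p \<in> trop_class M \<Sigma> ` ?N} = ?N"
  proof (intro equalityI subsetI)
    show "p \<in> ?N" if "p \<in> {p \<in> topspace ?X. trop_class M \<Sigma> p \<in> trop_class M \<Sigma> ` ?N}" for p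
      using that chart_image_class[OF M \<Sigma>] by blast
  qed (use openin_subset[OF openN] in blast)
  then have "openin (trop_toric M \<Sigma>) (trop_class M \<Sigma> ` ?N)"
    unfolding openin_trop_toric using openN openin_subset[OF openN] by (simp only: image_mono simp_thms)
  moreover have "(\<sigma>, \<phi>) \<in> ?N"
    using chart_imageI[OF \<Sigma>(2), of \<phi> M \<sigma> U] \<phi> U extensional_restrict[OF chart_point_extensional[OF \<phi>]]
    by simp
  then have "trop_class M \<Sigma> (\<sigma>, \<phi>) \<in> trop_class M \<Sigma> ` ?N" by (rule imageI)
  ultimately have "\<exists>y. y \<in> trop_embed M \<Sigma> ` L \<and> y \<in> trop_class M \<Sigma> ` ?N"
    by (rule closure_meets_open[OF closure])
  then obtain x where x: "x \<in> L" "trop_embed M \<Sigma> x \<in> trop_class M \<Sigma> ` ?N" by (elim exE conjE imageE) simp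
  let ?x = "restrict (\<lambda>u. ereal (x \<bullet> u)) (dual_monoid M \<sigma>)"
  from x(2) obtain p where p: "p \<in> ?N" "trop_class M \<Sigma> (\<sigma>, ?x) = trop_class M \<Sigma> p"
    unfolding trop_embed_chart[OF M \<Sigma>] by (rule imageE)
  have "(\<sigma>, ?x) \<in> ?N" by (rule chart_image_class[OF M \<Sigma> p])
  then obtain \<theta> where "restrict \<theta> (dual_monoid M \<sigma>) = ?x" "restrict \<theta> (dual_monoid M \<sigma>) \<in> U"
    by (rule chart_imageE)
  then have "?x \<in> U" by (simp only:)
  with x(1) show "\<exists>y. y \<in> (\<lambda>x. restrict (\<lambda>u. ereal (x \<bullet> u)) (dual_monoid M \<sigma>)) ` L \<and> y \<in> U"
    by blast
qed

lemma limitin_trop_toric: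
  fixes M :: "'a::euclidean_space set"
  assumes M: "full_lattice M" and \<Sigma>: "fan M \<Sigma>" "\<sigma> \<in> \<Sigma>"
    and \<phi>: "\<phi> \<in> trop_chart_points M \<sigma>"
    and lim: "\<And>u. u \<in> dual_monoid M \<sigma> \<Longrightarrow> ((\<lambda>t. ereal (x t \<bullet> u)) \<longlongrightarrow> \<phi> u) F"
  shows "limitin (trop_toric M \<Sigma>) (\<lambda>t. trop_embed M \<Sigma> (x t)) (trop_class M \<Sigma> (\<sigma>, \<phi>)) F"
proof -
  let ?x = "\<lambda>t. restrict (\<lambda>u. ereal (x t \<bullet> u)) (dual_monoid M \<sigma>)"
  have "limitin trop_numbers (\<lambda>t. ?x t u) (\<phi> u) F" if u: "u \<in> dual_monoid M \<sigma>" for u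
    using lim[OF u] chart_point_not_PInf[OF \<phi> u] u
    by (simp add: trop_numbers_def restrict_apply'[OF u] open_Compl)
  moreover have "?x t \<in> topspace (product_topology (\<lambda>_. trop_numbers) (dual_monoid M \<sigma>))" for t
    using linear_chart_point[OF M, of "x t" \<sigma>] by (simp add: trop_chart_points_def trop_numbers_def)
  ultimately have "limitin (trop_chart M \<sigma>) ?x \<phi> F"
    unfolding trop_chart_def limitin_subtopology limitin_componentwise
    using \<phi> linear_chart_point[OF M] chart_point_extensional[OF \<phi>] by (simp add: always_eventually)
  moreover have "continuous_map (trop_chart M \<sigma>) (trop_toric M \<Sigma>) (trop_class M \<Sigma> \<circ> (\<lambda>\<phi>. (\<sigma>, \<phi>)))"
    by (rule continuous_map_compose[OF continuous_map_component_injection[OF \<Sigma>(2)]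
          quotient_imp_continuous_map[OF quotient_map_trop_class]])
  ultimately show ?thesis
    using continuous_map_limit by (fastforce simp: o_def trop_embed_chart[OF M \<Sigma>])
qed

section \<open>Finiteness of the dual monoid\<close>

text \<open>
  Dickson's lemma, by induction on the number of coordinates. Disregarding the coordinate \<open>s\<close>, some
  finite \<open>G\<close> lies below all of \<open>T\<close>. It does so in the coordinate \<open>s\<close> as well above the level
  \<open>N\<close>, the largest \<open>s\<close>-coordinate in \<open>G\<close>; each of the finitely many levels below \<open>N\<close> is treated
  separately, with the coordinate \<open>s\<close> fixed.
\<close>

lemma dickson:
  fixes h :: "'b \<Rightarrow> 'c \<Rightarrow> nat"
  assumes "finite S"
  shows "\<exists>G\<subseteq>T. finite G \<and> (\<forall>t\<in>T. \<exists>g\<in>G. \<forall>s\<in>S. h g s \<le> h t s)"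
  using assms
proof (induction S arbitrary: T rule: finite_induct)
  case empty
  show ?case
  proof (cases "T = {}")
    case False
    then obtain t where "t \<in> T" by blast
    then show ?thesis by (intro exI[of _ "{t}"]) auto
  qed auto
next
  case (insert s S)
  obtain G where G: "G \<subseteq> T" "finite G" "\<And>t. t \<in> T \<Longrightarrow> \<exists>g\<in>G. \<forall>s\<in>S. h g s \<le> h t s"
    using insert.IH[of T] by blast
  define N where "N = Max (insert 0 ((\<lambda>g. h g s) ` G))"
  have N: "h g s \<le> N" if "g \<in> G" for g
    using G(2) that by (auto simp: N_def intro: Max_ge)
  have "\<forall>j. \<exists>G\<subseteq>{t \<in> T. h t s = j}. finite G \<and> (\<forall>t\<in>{t \<in> T. h t s = j}. \<exists>g\<in>G. \<forall>s\<in>S. h g s \<le> h t s)"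
    using insert.IH by blast
  from choice[OF this] obtain G' where G'_all: "\<forall>j. G' j \<subseteq> {t \<in> T. h t s = j} \<and> finite (G' j) \<and>
      (\<forall>t\<in>{t \<in> T. h t s = j}. \<exists>g\<in>G' j. \<forall>s\<in>S. h g s \<le> h t s)" ..
  have G': "G' j \<subseteq> {t \<in> T. h t s = j}" "finite (G' j)" for j
    using G'_all[rule_format, of j] by simp_all
  have G'_below: "\<exists>g\<in>G' (h t s). \<forall>s\<in>S. h g s \<le> h t s" if "t \<in> T" for t
    using G'_all[rule_format, of "h t s"] that by simp
  show ?case
  proof (intro exI[of _ "G \<union> (\<Union>j<N. G' j)"] conjI ballI)
    fix t assume t: "t \<in> T"
    show "\<exists>g\<in>G \<union> (\<Union>j<N. G' j). \<forall>s\<in>insert s S. h g s \<le> h t s"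
    proof (cases "h t s < N")
      case True
      obtain g where g: "g \<in> G' (h t s)" "\<forall>s\<in>S. h g s \<le> h t s" using G'_below[OF t] by blast
      then have "h g s = h t s" using G'(1) by blast
      with g True show ?thesis by (intro bexI[of _ g]) auto
    next
      case False
      obtain g where g: "g \<in> G" "\<forall>s\<in>S. h g s \<le> h t s" using G(3)[OF t] by blast
      with N[OF g(1)] False show ?thesis by (intro bexI[of _ g]) auto
    qed
  qed (use G(1,2) G'(2) subsetD[OF G'(1)] in auto)
qed

text \<open>
  The coordinates \<open>h\<close> embed the dual monoid, modulo its units, into a power of the natural numbers,
  where Dickson's lemma applies.
\<close>

lemma dual_monoid_height:
  fixes M :: "'a::euclidean_space set"
  assumes "rational_cone M \<sigma>"
  obtains S and h :: "'a \<Rightarrow> 'a \<Rightarrow> nat" where "finite S"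
    "\<And>u. u \<in> M \<Longrightarrow> u \<in> dual_monoid M \<sigma> \<longleftrightarrow> (\<forall>s\<in>S. s \<bullet> u \<le> 0)"
    "\<And>u s. u \<in> dual_monoid M \<sigma> \<Longrightarrow> s \<in> S \<Longrightarrow> real (h u s) = - (s \<bullet> u)"
proof -
  obtain S where S: "finite S" "S \<subseteq> dual_lattice M" "\<sigma> = convex_cone hull S"
    using assms unfolding rational_cone_def by blast
  have D: "u \<in> dual_monoid M \<sigma> \<longleftrightarrow> (\<forall>s\<in>S. s \<bullet> u \<le> 0)" if "u \<in> M" for u
    unfolding S(3) dual_cone_convex_cone_hull using that by blast
  have "real (nat \<lfloor>- (s \<bullet> u)\<rfloor>) = - (s \<bullet> u)" if u: "u \<in> dual_monoid M \<sigma>" and s: "s \<in> S" for u s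
  proof -
    have "s \<bullet> u \<in> \<int>" using S(2) s u unfolding dual_lattice_def by blast
    then obtain k where k: "s \<bullet> u = of_int k" by (rule Ints_cases)
    moreover have "s \<bullet> u \<le> 0" using D u s by blast
    ultimately have "k \<le> 0" by simp
    moreover have "\<lfloor>- (s \<bullet> u)\<rfloor> = - k" unfolding k of_int_minus[symmetric] by (rule floor_of_int)
    ultimately show ?thesis using k by simp
  qed
  with that[OF S(1), of "\<lambda>u s. nat \<lfloor>- (s \<bullet> u)\<rfloor>"] D show thesis by blast
qed

lemma finite_minimal_elements:
  fixes M :: "'a::euclidean_space set"
  assumes M: "full_lattice M" and \<sigma>: "rational_cone M \<sigma>" and T: "T \<subseteq> dual_monoid M \<sigma>"
  obtains G where "finite G" "G \<subseteq> T" "\<And>u. u \<in> T \<Longrightarrow> \<exists>g\<in>G. u - g \<in> dual_monoid M \<sigma>"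
proof -
  obtain S and h :: "'a \<Rightarrow> 'a \<Rightarrow> nat" where S: "finite S"
    and D: "\<And>u. u \<in> M \<Longrightarrow> u \<in> dual_monoid M \<sigma> \<longleftrightarrow> (\<forall>s\<in>S. s \<bullet> u \<le> 0)"
    and h: "\<And>u s. u \<in> dual_monoid M \<sigma> \<Longrightarrow> s \<in> S \<Longrightarrow> real (h u s) = - (s \<bullet> u)"
    using dual_monoid_height[OF \<sigma>] by blast
  obtain G where G: "G \<subseteq> T" "finite G" "\<forall>t\<in>T. \<exists>g\<in>G. \<forall>s\<in>S. h g s \<le> h t s"
    using dickson[OF S, of T h] by blast
  have "\<exists>g\<in>G. u - g \<in> dual_monoid M \<sigma>" if u: "u \<in> T" for u
  proof -
    obtain g where g: "g \<in> G" "\<forall>s\<in>S. h g s \<le> h u s" using G(3) u by blast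
    have uD: "u \<in> dual_monoid M \<sigma>" and gD: "g \<in> dual_monoid M \<sigma>" using u g(1) G(1) T by blast+
    have "s \<bullet> (u - g) \<le> 0" if s: "s \<in> S" for s
    proof -
      have "real (h g s) \<le> real (h u s)" using g(2) s by simp
      then show ?thesis unfolding h[OF uD s] h[OF gD s] by (simp add: inner_diff_right)
    qed
    moreover have "u - g \<in> M"
      using lattice_add[OF M, of u "- g"] lattice_minus[OF M, of g] uD gD by simp
    ultimately have "u - g \<in> dual_monoid M \<sigma>" using D by blast
    with g(1) show ?thesis by blast
  qed
  with that G(1,2) show thesis by blast
qed

text \<open>
  By induction on the sum of the heights of \<open>u\<close>: write \<open>u = g + d\<close> with \<open>g\<close> in \<open>G\<close>. Since \<open>-g\<close> is not in
  the monoid, \<open>g\<close> has positive height, so \<open>d\<close> has smaller height than \<open>u\<close>, whence \<open>d \<bullet> v \<le> 0\<close>.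
\<close>

lemma negative_on_dual_monoid:
  fixes M :: "'a::euclidean_space set"
  assumes M: "full_lattice M" and \<sigma>: "rational_cone M \<sigma>"
    and T: "T \<subseteq> dual_monoid M \<sigma>" "\<And>u. u \<in> T \<Longrightarrow> - u \<notin> dual_monoid M \<sigma>"
    and G: "G \<subseteq> T" "\<And>u. u \<in> T \<Longrightarrow> \<exists>g\<in>G. u - g \<in> dual_monoid M \<sigma>"
    and v: "\<And>u. u \<in> dual_monoid M \<sigma> - T \<Longrightarrow> u \<bullet> v = 0" "\<And>g. g \<in> G \<Longrightarrow> g \<bullet> v < 0"
    and u: "u \<in> T"
  shows "u \<bullet> v < 0"
proof -
  obtain S and h :: "'a \<Rightarrow> 'a \<Rightarrow> nat" where S: "finite S"
    and D: "\<And>u. u \<in> M \<Longrightarrow> u \<in> dual_monoid M \<sigma> \<longleftrightarrow> (\<forall>s\<in>S. s \<bullet> u \<le> 0)"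
    and h: "\<And>u s. u \<in> dual_monoid M \<sigma> \<Longrightarrow> s \<in> S \<Longrightarrow> real (h u s) = - (s \<bullet> u)"
    using dual_monoid_height[OF \<sigma>] by blast
  show ?thesis
    using u
  proof (induction "\<Sum>s\<in>S. h u s" arbitrary: u rule: less_induct)
    case less
    obtain g where g: "g \<in> G" and d: "u - g \<in> dual_monoid M \<sigma>" using G(2)[OF less.prems] by blast
    have uD: "u \<in> dual_monoid M \<sigma>" and gD: "g \<in> dual_monoid M \<sigma>"
      using less.prems g G(1) T(1) by blast+
    have split: "h u s = h g s + h (u - g) s" if s: "s \<in> S" for s
    proof -
      have "real (h u s) = real (h g s + h (u - g) s)"
        unfolding of_nat_add h[OF uD s] h[OF gD s] h[OF d s] by (simp add: inner_diff_right)
      then show ?thesis by (rule of_nat_eq_iff[THEN iffD1])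
    qed
    have "- g \<notin> dual_monoid M \<sigma>" using T(2) g G(1) by blast
    moreover have "- g \<in> M" using lattice_minus[OF M] gD by blast
    ultimately obtain s where s: "s \<in> S" "s \<bullet> (- g) > 0" using D by force
    then have "real (h g s) > 0" unfolding h[OF gD s(1)] by simp
    then have "h (u - g) s < h u s" using split[OF s(1)] by simp
    then have "(\<Sum>s\<in>S. h (u - g) s) < (\<Sum>s\<in>S. h u s)"
      using S s(1) split by (intro sum_strict_mono_ex1) auto
    then have "(u - g) \<bullet> v \<le> 0"
      using less.hyps[of "u - g"] v(1)[of "u - g"] d by (cases "u - g \<in> T") auto
    with v(2)[OF g] show ?case by (simp add: inner_diff_left)
  qed
qed

section \<open>Points of a chart in the closure of a polyhedron\<close>

lemma openin_Collect_ball_finite: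
  assumes "finite I" "\<And>i. i \<in> I \<Longrightarrow> openin X {x \<in> topspace X. P i x}"
  shows "openin X {x \<in> topspace X. \<forall>i\<in>I. P i x}"
  using assms
proof (induction I rule: finite_induct)
  case (insert i I)
  have "{x \<in> topspace X. \<forall>j\<in>insert i I. P j x} = {x \<in> topspace X. P i x} \<inter> {x \<in> topspace X. \<forall>j\<in>I. P j x}"
    by blast
  then show ?case using insert by auto
qed auto

lemma chart_closure_approx:
  fixes L :: "'a::euclidean_space set"
  assumes closure: "\<phi> \<in> trop_chart M \<sigma> closure_of ((\<lambda>x. restrict (\<lambda>u. ereal (x \<bullet> u)) (dual_monoid M \<sigma>)) ` L)"
    and A: "finite A" "\<And>a. a \<in> A \<Longrightarrow> a \<in> dual_monoid M \<sigma> \<and> \<phi> a \<noteq> - \<infinity>"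
    and G: "finite G" "\<And>g. g \<in> G \<Longrightarrow> g \<in> dual_monoid M \<sigma> \<and> \<phi> g = - \<infinity>"
    and e: "e > 0"
  shows "\<exists>x\<in>L. (\<forall>a\<in>A. \<bar>a \<bullet> x - real_of_ereal (\<phi> a)\<bar> < e) \<and> (\<forall>g\<in>G. g \<bullet> x \<le> - K)"
proof -
  let ?X = "trop_chart M \<sigma>"
  let ?c = "\<lambda>a. real_of_ereal (\<phi> a)"
  define W where "W = (\<lambda>u. if u \<in> A then {ereal (?c u - e)<..<ereal (?c u + e)} else {..<ereal (- K)})"
  have \<phi>: "\<phi> \<in> topspace ?X" using closure by (simp add: in_closure_of)
  have AG: "u \<in> dual_monoid M \<sigma>" if "u \<in> A \<union> G" for u using that A(2) G(2) by blast
  have "open (W u)" for u by (simp add: W_def)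
  then have "openin ?X {\<psi> \<in> topspace ?X. \<psi> u \<in> W u}" if "u \<in> A \<union> G" for u
    using openin_continuous_map_preimage[OF continuous_map_chart_coordinate[OF AG[OF that]]] by simp
  then have op: "openin ?X {\<psi> \<in> topspace ?X. \<forall>u\<in>A \<union> G. \<psi> u \<in> W u}"
    using A(1) G(1) by (intro openin_Collect_ball_finite) auto
  have fin: "\<phi> a = ereal (?c a)" if "a \<in> A" for a
    using A(2)[OF that] \<phi> chart_point_not_PInf[of \<phi> M \<sigma> a]
    by (cases "\<phi> a") (auto simp: topspace_trop_chart)
  have "\<phi> u \<in> W u" if "u \<in> A \<union> G" for u
  proof (cases "u \<in> A")
    case True
    have "ereal (?c u) \<in> {ereal (?c u - e)<..<ereal (?c u + e)}" using e by simp
    with True fin[OF True] show ?thesis by (simp only: W_def if_True)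
  next
    case False
    with that G(2) show ?thesis by (simp add: W_def)
  qed
  then have "\<phi> \<in> {\<psi> \<in> topspace ?X. \<forall>u\<in>A \<union> G. \<psi> u \<in> W u}" using \<phi> by blast
  from closure_meets_open[OF closure op this] obtain x where x: "x \<in> L"
    "\<And>u. u \<in> A \<union> G \<Longrightarrow> restrict (\<lambda>u. ereal (x \<bullet> u)) (dual_monoid M \<sigma>) u \<in> W u"
    by (elim exE conjE imageE) blast
  have xW: "ereal (x \<bullet> u) \<in> W u" if "u \<in> A \<union> G" for u
    using x(2)[OF that] unfolding restrict_apply'[OF AG[OF that]] .
  have "\<bar>a \<bullet> x - ?c a\<bar> < e" if "a \<in> A" for a
    using xW[of a] that by (simp add: W_def inner_commute abs_less_iff)
  moreover have "g \<bullet> x \<le> - K" if "g \<in> G" for g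
  proof -
    have "g \<notin> A" using A(2) G(2) that by blast
    then show ?thesis using xW[of g] that by (simp add: W_def inner_commute)
  qed
  ultimately show ?thesis using x(1) by blast
qed

text \<open>
  It has to be shown that a \<open>w\<close> with the right values on a basis \<open>A\<close> of the span of \<open>F\<close> has them on
  all of \<open>F\<close>, although \<open>\<phi>\<close> is only known to be additive on a monoid. Rather than extending \<open>\<phi>\<close>
  linearly, for each \<open>u\<close> in \<open>F\<close> the closure hypothesis is used once more, for \<open>A\<close> and \<open>u\<close> together:
  it gives an \<open>x\<close> with the right values on both, and \<open>x\<close> and \<open>w\<close> agree on the span of \<open>A\<close>.
\<close>

lemma point_and_direction_for_chart_point:
  fixes M :: "'a::euclidean_space set"
  assumes M: "full_lattice M" and \<sigma>: "rational_cone M \<sigma>" and L: "polyhedron L"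
    and closure: "\<phi> \<in> trop_chart M \<sigma> closure_of ((\<lambda>x. restrict (\<lambda>u. ereal (x \<bullet> u)) (dual_monoid M \<sigma>)) ` L)"
  obtains w v where "w \<in> L" "v \<in> recession_cone L"
    "\<forall>u\<in>dual_monoid M \<sigma>. if \<phi> u = - \<infinity> then u \<bullet> v < 0 else \<phi> u = ereal (u \<bullet> w) \<and> u \<bullet> v = 0"
proof -
  let ?D = "dual_monoid M \<sigma>"
  let ?c = "\<lambda>u. real_of_ereal (\<phi> u)"
  define F where "F = {u \<in> ?D. \<phi> u \<noteq> - \<infinity>}"
  define T where "T = {u \<in> ?D. \<phi> u = - \<infinity>}"
  have \<phi>: "\<phi> \<in> trop_chart_points M \<sigma>" using closure by (simp add: in_closure_of topspace_trop_chart)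
  obtain G where G: "finite G" "G \<subseteq> T" "\<And>u. u \<in> T \<Longrightarrow> \<exists>g\<in>G. u - g \<in> ?D"
    using finite_minimal_elements[OF M \<sigma>, of T] unfolding T_def by blast
  obtain A where A: "A \<subseteq> F" "independent A" "F \<subseteq> span A" by (rule maximal_independent_subset)
  have finA: "finite A" using A(2) by (rule independent_imp_finite)
  note approx = chart_closure_approx[OF closure]
  obtain w v where w: "w \<in> L" and v: "v \<in> recession_cone L"
    and wA: "\<And>a. a \<in> A \<Longrightarrow> a \<bullet> w = ?c a" and vA: "\<And>a. a \<in> A \<Longrightarrow> a \<bullet> v = 0"
    and vG: "\<And>g. g \<in> G \<Longrightarrow> g \<bullet> v < 0"
  proof -
    have "\<exists>w\<in>L. \<exists>v\<in>recession_cone L. (\<forall>a\<in>A. a \<bullet> w = ?c a \<and> a \<bullet> v = 0) \<and> (\<forall>g\<in>G. g \<bullet> v < 0)"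
      by (rule polyhedron_point_and_direction[OF L finA G(1)], rule approx[OF finA _ G(1)])
        (use A(1) G(2) in \<open>auto simp: F_def T_def\<close>)
    then show thesis using that by blast
  qed
  have F: "u \<bullet> w = ?c u" "u \<bullet> v = 0" if u: "u \<in> F" for u
  proof -
    have uA: "u \<in> span A" using u A(3) by blast
    have "\<exists>x\<in>L. \<exists>v\<in>recession_cone L. (\<forall>a\<in>insert u A. a \<bullet> x = ?c a \<and> a \<bullet> v = 0) \<and> (\<forall>g\<in>{}. g \<bullet> v < 0)"
      by (rule polyhedron_point_and_direction[OF L], use finA in simp, simp, rule approx)
        (use A(1) u finA in \<open>auto simp: F_def\<close>)
    then obtain x where x: "u \<bullet> x = ?c u" "\<And>a. a \<in> A \<Longrightarrow> a \<bullet> x = ?c a" by blast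
    have "orthogonal (w - x) u"
      by (rule orthogonal_to_span[OF uA])
        (use wA x(2) in \<open>simp add: orthogonal_def inner_commute[of "w - x"] inner_diff_right\<close>)
    then show "u \<bullet> w = ?c u"
      using x(1) by (simp add: orthogonal_def inner_commute[of "w - x"] inner_diff_right)
    have "orthogonal v u"
      by (rule orthogonal_to_span[OF uA]) (use vA in \<open>simp add: orthogonal_def inner_commute\<close>)
    then show "u \<bullet> v = 0" by (simp add: orthogonal_def inner_commute)
  qed
  \<comment> \<open>\<open>\<phi>\<close> is finite on units of the monoid.\<close>
  have neg: "- u \<notin> ?D" if u: "u \<in> T" for u
  proof
    assume "- u \<in> ?D"
    moreover have "u \<in> ?D" using u by (simp add: T_def)
    ultimately have "\<phi> u + \<phi> (- u) = 0" "\<phi> (- u) \<noteq> \<infinity>"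
      using chart_point_add[OF \<phi>, of u "- u"] chart_point_0[OF \<phi>] chart_point_not_PInf[OF \<phi>, of "- u"]
      by simp_all
    then show False using u by (cases "\<phi> (- u)") (auto simp: T_def)
  qed
  have T: "T \<subseteq> ?D" by (auto simp: T_def)
  have negative: "u \<bullet> v < 0" if "u \<in> T" for u
    by (rule negative_on_dual_monoid[OF M \<sigma> T neg G(2,3) F(2) vG that]) (auto simp: F_def T_def)
  have finite_value: "\<phi> u = ereal (u \<bullet> w)" if "u \<in> F" for u
    using F(1)[OF that] that chart_point_not_PInf[OF \<phi>, of u] by (cases "\<phi> u") (auto simp: F_def)
  show thesis
  proof (rule that[OF w v], rule ballI)
    fix u assume u: "u \<in> ?D"
    show "if \<phi> u = - \<infinity> then u \<bullet> v < 0 else \<phi> u = ereal (u \<bullet> w) \<and> u \<bullet> v = 0"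
    proof (cases "\<phi> u = - \<infinity>")
      case True
      then have "u \<in> T" using u by (simp add: T_def)
      with True negative show ?thesis by simp
    next
      case False
      then have "u \<in> F" using u by (simp add: F_def)
      from finite_value[OF this] F(2)[OF this] False show ?thesis by simp
    qed
  qed
qed

theorem theorem1p7:
  fixes M :: "'a::euclidean_space set" and \<Sigma> :: "'a set set"
    and w :: "('a set \<times> ('a \<Rightarrow> ereal)) set" and L :: "'a set"
  assumes "full_lattice M"
    and "fan M \<Sigma>"
    and "w \<in> topspace (trop_toric M \<Sigma>) - range (trop_embed M \<Sigma>)"
    and "polyhedron L"
    and "w \<in> trop_toric M \<Sigma> closure_of (trop_embed M \<Sigma> ` L)"
  shows "\<exists>w'\<in>L. \<exists>v\<in>recession_cone L.
           limitin (trop_toric M \<Sigma>) (\<lambda>t::real. trop_embed M \<Sigma> (w' + t *\<^sub>R v)) w at_top"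
proof -
  note M = assms(1) and \<Sigma> = assms(2)
  have "w \<in> trop_class M \<Sigma> ` topspace (sum_topology (trop_chart M) \<Sigma>)"
    using assms(3) quotient_imp_surjective_map[OF quotient_map_trop_class, of M \<Sigma>] by blast
  then obtain \<sigma> \<phi> where \<sigma>: "\<sigma> \<in> \<Sigma>" and \<phi>: "\<phi> \<in> trop_chart_points M \<sigma>" and w: "w = trop_class M \<Sigma> (\<sigma>, \<phi>)"
    by (auto simp: topspace_trop_chart)
  obtain w' v where w': "w' \<in> L" and v: "v \<in> recession_cone L"
    and wv: "\<forall>u\<in>dual_monoid M \<sigma>. if \<phi> u = - \<infinity> then u \<bullet> v < 0 else \<phi> u = ereal (u \<bullet> w') \<and> u \<bullet> v = 0"
    by (rule point_and_direction_for_chart_point[OF M fanD(1)[OF \<Sigma> \<sigma> \<sigma>] assms(4)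
        chart_closure[OF M \<Sigma> \<sigma> \<phi> assms(5)[unfolded w]]])
  have "limitin (trop_toric M \<Sigma>) (\<lambda>t::real. trop_embed M \<Sigma> (w' + t *\<^sub>R v)) w at_top"
    unfolding w
  proof (rule limitin_trop_toric[OF M \<Sigma> \<sigma> \<phi>])
    fix u assume u: "u \<in> dual_monoid M \<sigma>"
    note wvu = bspec[OF wv u]
    show "((\<lambda>t. ereal ((w' + t *\<^sub>R v) \<bullet> u)) \<longlongrightarrow> \<phi> u) at_top"
    proof (cases "\<phi> u = - \<infinity>")
      case False
      then have "(\<lambda>t. ereal ((w' + t *\<^sub>R v) \<bullet> u)) = (\<lambda>t. \<phi> u)"
        using wvu by (simp add: inner_add_right inner_commute[of _ u])
      then show ?thesis by simp
    next
      case True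
      have "\<forall>\<^sub>F t in at_top. ereal ((w' + t *\<^sub>R v) \<bullet> u) < ereal r" for r
        using eventually_gt_at_top[of "(r - w' \<bullet> u) / (v \<bullet> u)"]
      proof eventually_elim
        case (elim t)
        have "v \<bullet> u < 0" using wvu True by (simp add: inner_commute)
        with elim show ?case by (simp add: inner_add_left field_simps)
      qed
      then show ?thesis unfolding True tendsto_MInfty by blast
    qed
  qed
  with w' v show ?thesis by blast
qed

end
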